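(* Let $A(x,y)=\sum_{P}x^{\mathrm{width}(P)}y^{\mathrm{area}(P)}$, the sum being over all packing paths $P$. Then $$A(x,y)=\cfrac{1}{1-\cfrac{2x^4y}{1-2x^4y-\cfrac{x^4y^2}{1-3x^4y^2-\cfrac{x^4y^3}{1-3x^4y^3-\ddots}}}},$$ that is, $A(x,y)=\dfrac{1}{1-\dfrac{2x^4y}{1-2x^4y-K_2}}$ where, for $j\ge2$, $K_j=\dfrac{x^4y^j}{1-3x^4y^j-K_{j+1}}$ (the infinite continued fraction being understood as a limit of formal power series).
   Context: Consider the hexagonal packing of the plane by circles of radius $2$ with centers $(2+4i+2j,\,2\sqrt3\,j)$, $i,j\in\mathbb Z$; the origin is the tangency point of two horizontally adjacent circles. The tangency points cut every circle into six arcs. Traversed from left to right these give six types of steps (angles measured on the circle carrying the arc): $U$ from $180^\circ$ to $120^\circ$ (displacement $(1,\sqrt3)$), $F$ from $120^\circ$ to $60^\circ$ (displacement $(2,0)$), $D$ from $60^\circ$ to $0^\circ$ (displacement $(1,-\sqrt3)$), $\overline U$ from $300^\circ$ to $360^\circ$ (displacement $(1,\sqrt3)$), $\overline F$ from $240^\circ$ to $300^\circ$ (displacement $(2,0)$), $\overline D$ from $180^\circ$ to $240^\circ$ (displacement $(1,-\sqrt3)$). A path in the packing starts at the origin, is a concatenation of such arcs of circles of the packing, each starting where the previous one ends, and stays in the quarter plane $x,y\ge 0$. Equivalently, it is a word in $\{U,F,D,\overline U,\overline F,\overline D\}$ whose first step (if any) is $U$, in which $U$ or $\overline F$ can only be followed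 by $F$ or $\overline U$; $F$ or $\overline D$ only by $\overline F$ or $D$; $\overline U$ or $D$ only by $U$ or $\overline D$; and which never goes below ordinate $0$. A packing path is such a path ending on the $x$-axis. The empty path is allowed. The width of a path is the abscissa of its endpoint (so $U,D,\overline U,\overline D$ contribute $1$ and $F,\overline F$ contribute $2$). The area of a packing path is the number of circles of the packing lying below the path and above the line $y=-2$ (i.e. circles with center of ordinate $\ge0$ lying under the path, between its starting and ending abscissas). *)

theory Defs
  imports
    "HOL-Complex_Analysis.Complex_Analysis"
    "HOL-Computational_Algebra.Formal_Power_Series"
begin

text \<open>The plane is identified with the complex numbers; circles of the packing have radius 2
  and are given by their centres.\<close>

definition centers :: "complex set" where
  "centers = {Complex (2 + 4 * of_int i + 2 * of_int j) (2 * sqrt 3 * of_int j) | i j :: int. True}"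

datatype step = Up | Flat | Down | UpBar | FlatBar | DownBar

text \<open>Angles, on the circle carrying the arc, at which a step begins and ends.\<close>

fun start_angle :: "step \<Rightarrow> real" where
  "start_angle Up = pi"
| "start_angle Flat = 2 * pi / 3"
| "start_angle Down = pi / 3"
| "start_angle UpBar = 5 * pi / 3"
| "start_angle FlatBar = 4 * pi / 3"
| "start_angle DownBar = pi"

fun end_angle :: "step \<Rightarrow> real" where
  "end_angle Up = 2 * pi / 3"
| "end_angle Flat = pi / 3"
| "end_angle Down = 0"
| "end_angle UpBar = 2 * pi"
| "end_angle FlatBar = 5 * pi / 3"
| "end_angle DownBar = 4 * pi / 3"

definition arc_center :: "complex \<Rightarrow> step \<Rightarrow> complex" where
  "arc_center p s = p - 2 * cis (start_angle s)"

definition arc_points :: "complex \<Rightarrow> step \<Rightarrow> complex set" where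
  "arc_points p s = path_image (part_circlepath (arc_center p s) 2 (start_angle s) (end_angle s))"

definition arc_end :: "complex \<Rightarrow> step \<Rightarrow> complex" where
  "arc_end p s = arc_center p s + 2 * cis (end_angle s)"

text \<open>In the following three functions the first argument is the starting point of the path.\<close>

fun on_packing :: "complex \<Rightarrow> step list \<Rightarrow> bool" where
  "on_packing p [] \<longleftrightarrow> True"
| "on_packing p (s # w) \<longleftrightarrow> arc_center p s \<in> centers \<and> on_packing (arc_end p s) w"

fun path_points :: "complex \<Rightarrow> step list \<Rightarrow> complex set" where
  "path_points p [] = {p}"
| "path_points p (s # w) = arc_points p s \<union> path_points (arc_end p s) w"

fun endpoint :: "complex \<Rightarrow> step list \<Rightarrow> complex" where
  "endpoint p [] = p"
| "endpoint p (s # w) = endpoint (arc_end p s) w"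

definition path_in_packing :: "step list \<Rightarrow> bool" where
  "path_in_packing w \<longleftrightarrow> on_packing 0 w \<and> path_points 0 w \<subseteq> {z. 0 \<le> Re z \<and> 0 \<le> Im z}"

definition packing_path :: "step list \<Rightarrow> bool" where
  "packing_path w \<longleftrightarrow> path_in_packing w \<and> Im (endpoint 0 w) = 0"

definition width :: "step list \<Rightarrow> real" where
  "width w = Re (endpoint 0 w)"

text \<open>The circle with centre \<open>c\<close> lies under the path if every point of the circle has a point
  of the path at or above it; in particular the circle then lies between the two end abscissas.\<close>

definition circle_under :: "complex \<Rightarrow> step list \<Rightarrow> bool" where
  "circle_under c w \<longleftrightarrow> (\<forall>z \<in> sphere c 2. \<exists>v \<in> path_points 0 w. Re v = Re z \<and> Im z \<le> Im v)"

definition area :: "step list \<Rightarrow> nat" where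
  "area w = card {c \<in> centers. 0 \<le> Im c \<and> circle_under c w}"

text \<open>Power series in \<open>x\<close> whose coefficients are power series in \<open>y\<close>. Limits in this type are
  \<open>x\<close>-adic, with discrete coefficients. Denominators below have constant coefficient 1 in \<open>x\<close>, and
  division by such a series is genuine division (see \<open>fps_divide_mult_cancel\<close>).\<close>

abbreviation X :: "rat fps fps" where "X \<equiv> fps_X"
abbreviation Y :: "rat fps fps" where "Y \<equiv> fps_const fps_X"

definition packing_gf :: "rat fps fps" where
  "packing_gf = Abs_fps (\<lambda>n. Abs_fps (\<lambda>k.
     of_nat (card {w. packing_path w \<and> width w = real n \<and> area w = k})))"

text \<open>\<open>cf_tail n j\<close> keeps the first \<open>n\<close> levels of the tail starting at index \<open>j\<close>.\<close>

fun cf_tail :: "nat \<Rightarrow> nat \<Rightarrow> rat fps fps" where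
  "cf_tail 0 j = 0"
| "cf_tail (Suc n) j = X ^ 4 * Y ^ j / (1 - 3 * X ^ 4 * Y ^ j - cf_tail n (Suc j))"

lemma fps_divide_mult_cancel:
  fixes f g :: "rat fps fps"
  assumes "fps_nth g 0 = 1"
  shows "f / g * g = f"
proof -
  have "f / g = f * inverse g"
    using assms by (intro fps_divide_unit) simp
  moreover have "g * inverse g = 1"
    unfolding fps_inverse_def using assms by (intro fps_right_inverse) simp
  ultimately show ?thesis by (simp add: mult.assoc mult.commute[of "inverse g"])
qed


subsection \<open>Words\<close>

text \<open>The description of paths as words, shown below to agree with the geometric one.\<close>

fun disp :: "step \<Rightarrow> complex" where
  "disp Up = Complex 1 (sqrt 3)"
| "disp Flat = Complex 2 0"
| "disp Down = Complex 1 (- sqrt 3)"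
| "disp UpBar = Complex 1 (sqrt 3)"
| "disp FlatBar = Complex 2 0"
| "disp DownBar = Complex 1 (- sqrt 3)"

fun follows :: "step \<Rightarrow> step set" where
  "follows Up = {Flat, UpBar}"
| "follows FlatBar = {Flat, UpBar}"
| "follows Flat = {FlatBar, Down}"
| "follows DownBar = {FlatBar, Down}"
| "follows UpBar = {Up, DownBar}"
| "follows Down = {Up, DownBar}"

lemma cis_values:
  "cis (pi / 3) = Complex (1 / 2) (sqrt 3 / 2)"
  "cis (2 * pi / 3) = Complex (- 1 / 2) (sqrt 3 / 2)"
  "cis (4 * pi / 3) = Complex (- 1 / 2) (- sqrt 3 / 2)"
  "cis (5 * pi / 3) = Complex (1 / 2) (- sqrt 3 / 2)"
proof -
  show 1: "cis (pi / 3) = Complex (1 / 2) (sqrt 3 / 2)"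
    by (simp add: complex_eq_iff cos_60 sin_60)
  have e: "cis (2 * pi / 3) = cis (pi / 3) * cis (pi / 3)"
    "cis (4 * pi / 3) = cis pi * cis (pi / 3)"
    "cis (5 * pi / 3) = cis pi * (cis (pi / 3) * cis (pi / 3))"
    by (simp_all add: cis_mult del: cis_pi)
  show "cis (2 * pi / 3) = Complex (- 1 / 2) (sqrt 3 / 2)"
    "cis (4 * pi / 3) = Complex (- 1 / 2) (- sqrt 3 / 2)"
    "cis (5 * pi / 3) = Complex (1 / 2) (- sqrt 3 / 2)"
    unfolding e 1 by (simp_all add: complex_eq_iff)
qed

lemma arc_end_eq: "arc_end p s = p + disp s"
  by (cases s) (simp_all add: arc_end_def arc_center_def cis_values complex_eq_iff)

lemma endpoint_eq: "endpoint p w = p + (\<Sum>s\<leftarrow>w. disp s)"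
  by (induction w arbitrary: p) (simp_all add: arc_end_eq)

fun step_width :: "step \<Rightarrow> nat" where
  "step_width Flat = 2"
| "step_width FlatBar = 2"
| "step_width _ = 1"

lemma width_eq: "width w = real (\<Sum>s\<leftarrow>w. step_width s)"
proof -
  have "Re (disp s) = real (step_width s)" for s by (cases s) simp_all
  then show ?thesis unfolding width_def endpoint_eq
    by (induction w) simp_all
qed

lemma finite_width: "finite {w. width w = real n}"
proof (rule finite_subset)
  have "length w \<le> (\<Sum>s\<leftarrow>w. step_width s)" for w
  proof (induction w)
    case (Cons s w)
    then show ?case by (cases s) simp_all
  qed simp
  then show "{w. width w = real n} \<subseteq> {w. set w \<subseteq> UNIV \<and> length w \<le> n}"
    by (auto simp: width_eq)
  have "finite (UNIV :: step set)"
    by (rule finite_subset[of _ "{Up, Flat, Down, UpBar, FlatBar, DownBar}"])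
      (use step.exhaust in auto)
  then show "finite {w. set (w :: step list) \<subseteq> UNIV \<and> length w \<le> n}"
    by (rule finite_lists_length_le)
qed


definition lattice_point :: "int \<Rightarrow> int \<Rightarrow> complex" where
  "lattice_point a b = Complex (of_int a) (sqrt 3 * of_int b)"

lemma lattice_point_simps [simp]:
  "Re (lattice_point a b) = of_int a" "Im (lattice_point a b) = sqrt 3 * of_int b"
  by (simp_all add: lattice_point_def)

lemma lattice_point_in_centers:
  "lattice_point a b \<in> centers \<longleftrightarrow> even b \<and> (a - b) mod 4 = 2"
proof
  assume "lattice_point a b \<in> centers"
  then obtain i j :: int where "of_int a = (of_int (2 + 4 * i + 2 * j) :: real)"
    "sqrt 3 * of_int b = sqrt 3 * (of_int (2 * j) :: real)"
    by (auto simp: centers_def complex_eq_iff)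
  then have "a = 2 + 4 * i + 2 * j" "b = 2 * j"
    by (simp_all only: of_int_eq_iff mult_cancel_left real_sqrt_eq_0_iff) simp_all
  then show "even b \<and> (a - b) mod 4 = 2" by (simp add: mod_add_left_eq)
next
  assume "even b \<and> (a - b) mod 4 = 2"
  then obtain j where b: "b = 2 * j" and "(a - 2 * j) mod 4 = 2" by blast
  then have a: "a = 2 + 4 * ((a - 2 * j) div 4) + 2 * j" by presburger
  have "lattice_point a b =
      Complex (2 + 4 * of_int ((a - 2 * j) div 4) + 2 * of_int j) (2 * sqrt 3 * of_int j)"
    unfolding b by (subst a) (simp add: complex_eq_iff)
  then show "lattice_point a b \<in> centers" unfolding centers_def by blast
qed

definition tangency :: "int \<Rightarrow> int \<Rightarrow> bool" where
  "tangency a b \<longleftrightarrow> (a - b) mod 4 = 0 \<or> odd b \<and> (a - b) mod 4 = 2"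

definition allowed :: "int \<Rightarrow> int \<Rightarrow> step set" where
  "allowed a b =
     (if (a - b) mod 4 = 0 then if even b then {Up, DownBar} else {Flat, UpBar}
      else {FlatBar, Down})"

fun disp_x :: "step \<Rightarrow> int" where
  "disp_x Flat = 2" | "disp_x FlatBar = 2" | "disp_x _ = 1"

fun disp_y :: "step \<Rightarrow> int" where
  "disp_y Up = 1" | "disp_y UpBar = 1" | "disp_y Down = -1" | "disp_y DownBar = -1"
| "disp_y _ = 0"

fun center_x :: "step \<Rightarrow> int" where
  "center_x Up = 2" | "center_x DownBar = 2" | "center_x Down = -1" | "center_x UpBar = -1"
| "center_x _ = 1"

fun center_y :: "step \<Rightarrow> int" where
  "center_y Up = 0" | "center_y DownBar = 0" | "center_y Flat = -1" | "center_y Down = -1"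
| "center_y _ = 1"

lemma arc_end_lattice:
  "arc_end (lattice_point a b) s = lattice_point (a + disp_x s) (b + disp_y s)"
  unfolding arc_end_eq by (cases s) (simp_all add: complex_eq_iff algebra_simps)

lemma arc_center_lattice:
  "arc_center (lattice_point a b) s = lattice_point (a + center_x s) (b + center_y s)"
  unfolding arc_center_def
  by (cases s; simp add: cis_values complex_eq_iff; simp add: algebra_simps)

lemma arc_center_in_centers:
  assumes "tangency a b"
  shows "arc_center (lattice_point a b) s \<in> centers \<longleftrightarrow> s \<in> allowed a b"
proof -
  have "(a - b) mod 4 = 0 \<or> odd b \<and> (a - b) mod 4 = 2"
    using assms by (simp add: tangency_def)
  then have
    "even b \<and> (a + 2 - b) mod 4 = 2 \<longleftrightarrow> (a - b) mod 4 = 0 \<and> even b"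
    "even (b - 1) \<and> (a + 1 - (b - 1)) mod 4 = 2 \<longleftrightarrow> (a - b) mod 4 = 0 \<and> odd b"
    "even (b + 1) \<and> (a - 1 - (b + 1)) mod 4 = 2 \<longleftrightarrow> (a - b) mod 4 = 0 \<and> odd b"
    "even (b - 1) \<and> (a - 1 - (b - 1)) mod 4 = 2 \<longleftrightarrow> (a - b) mod 4 \<noteq> 0"
    "even (b + 1) \<and> (a + 1 - (b + 1)) mod 4 = 2 \<longleftrightarrow> (a - b) mod 4 \<noteq> 0"
    by presburger+
  then show ?thesis
    unfolding arc_center_lattice lattice_point_in_centers allowed_def
    by (cases s) simp_all
qed

lemma tangency_step:
  assumes "tangency a b" "s \<in> allowed a b"
  shows "tangency (a + disp_x s) (b + disp_y s)"
    and "allowed (a + disp_x s) (b + disp_y s) = follows s"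
proof -
  show "tangency (a + disp_x s) (b + disp_y s)"
    using assms by (cases s; simp add: tangency_def allowed_def split: if_splits; presburger)
  consider "(a - b) mod 4 = 0" "even b" "s = Up \<or> s = DownBar"
    | "(a - b) mod 4 = 0" "odd b" "s = Flat \<or> s = UpBar"
    | "(a - b) mod 4 = 2" "odd b" "s = FlatBar \<or> s = Down"
    using assms by (auto simp: tangency_def allowed_def split: if_splits)
  then show "allowed (a + disp_x s) (b + disp_y s) = follows s"
  proof cases
    case 1
    from 1(1,2) have "(a + 1 - (b + 1)) mod 4 = 0" "(a + 1 - (b - 1)) mod 4 = 2" "odd (b + 1)" "odd (b - 1)"
      by presburger+
    with 1 show ?thesis by (auto simp: allowed_def)
  next
    case 2
    from 2(1,2) have "(a + 2 - b) mod 4 = 2" "(a + 1 - (b + 1)) mod 4 = 0" "even (b + 1)"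
      by presburger+
    with 2 show ?thesis by (auto simp: allowed_def)
  next
    case 3
    from 3(1,2) have "(a + 2 - b) mod 4 = 0" "(a + 1 - (b - 1)) mod 4 = 0" "even (b - 1)"
      by presburger+
    with 3 show ?thesis by (auto simp: allowed_def)
  qed
qed

lemma on_packing_iff:
  assumes "tangency a b"
  shows "on_packing (lattice_point a b) w \<longleftrightarrow>
    (w \<noteq> [] \<longrightarrow> hd w \<in> allowed a b) \<and> successively (\<lambda>s t. t \<in> follows s) w"
  using assms
proof (induction w arbitrary: a b)
  case (Cons s w)
  then show ?case
    using tangency_step[of a b s]
    by (auto simp: arc_center_in_centers arc_end_lattice successively_Cons)
qed simp

lemma endpoint_in_path_points: "endpoint p (take k w) \<in> path_points p w"
proof -
  have start: "p \<in> path_points p w" for p w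
  proof (cases w)
    case (Cons s v)
    have "p = arc_center p s + 2 * cis (start_angle s)" by (simp add: arc_center_def)
    then show ?thesis using Cons
      by (simp add: arc_points_def path_image_part_circlepath')
  qed simp
  show ?thesis
  proof (induction w arbitrary: p k)
    case (Cons s w)
    then show ?case using start[of p "s # w"] by (cases k) auto
  qed simp
qed

lemma sin_lower_bounds:
  "\<And>t. t \<in> {0..pi} \<Longrightarrow> 0 \<le> sin t"
  "\<And>t. t \<in> {pi..4 * pi / 3} \<Longrightarrow> - sqrt 3 / 2 \<le> sin t"
  "\<And>t. t \<in> {5 * pi / 3..2 * pi} \<Longrightarrow> - sqrt 3 / 2 \<le> sin t"
  "\<And>t. t \<in> {pi / 3..2 * pi / 3} \<Longrightarrow> sqrt 3 / 2 \<le> sin t"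
proof -
  have mono: "sin x \<le> sin y" if "0 \<le> x" "x \<le> y" "y \<le> pi / 2" for x y :: real
    using that by (intro sin_monotone_2pi_le) auto
  have s: "sin (pi / 3) = sqrt 3 / 2" by (rule sin_60)
  fix t :: real
  show "0 \<le> sin t" if "t \<in> {0..pi}" using that by (intro sin_ge_zero) auto
  show "- sqrt 3 / 2 \<le> sin t" if "t \<in> {pi..4 * pi / 3}"
  proof -
    have "sin (t - pi) \<le> sin (pi / 3)" using that by (intro mono) auto
    then show ?thesis by (simp add: s)
  qed
  show "- sqrt 3 / 2 \<le> sin t" if "t \<in> {5 * pi / 3..2 * pi}"
  proof -
    have "sin (2 * pi - t) \<le> sin (pi / 3)" using that by (intro mono) auto
    then show ?thesis by (simp add: s sin_diff)
  qed
  show "sqrt 3 / 2 \<le> sin t" if "t \<in> {pi / 3..2 * pi / 3}"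
  proof (cases "t \<le> pi / 2")
    case True
    then have "sin (pi / 3) \<le> sin t" using that by (intro mono) auto
    then show ?thesis by (simp add: s)
  next
    case False
    then have "sin (pi / 3) \<le> sin (pi - t)" using that by (intro mono) auto
    then show ?thesis by (simp add: s)
  qed
qed

lemma cos_ge_start_angle:
  assumes "t \<in> closed_segment (start_angle s) (end_angle s)"
  shows "cos (start_angle s) \<le> cos t"
proof -
  have t: "t \<in> (if start_angle s \<le> end_angle s then {start_angle s..end_angle s}
      else {end_angle s..start_angle s})"
    using assms by (simp add: closed_segment_eq_real_ivl)
  have up: "cos (start_angle s) \<le> cos t" if "0 \<le> t" "t \<le> start_angle s" "start_angle s \<le> pi"
    using that by (intro cos_monotone_0_pi_le) auto
  have "cos (2 * pi - start_angle s) \<le> cos (2 * pi - t)"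
    if "pi \<le> start_angle s" "start_angle s \<le> t" "t \<le> 2 * pi"
    using that by (intro cos_monotone_0_pi_le) auto
  then have low: "cos (start_angle s) \<le> cos t"
    if "pi \<le> start_angle s" "start_angle s \<le> t" "t \<le> 2 * pi"
    using that by (simp add: cos_diff)
  show ?thesis using t up low pi_gt_zero by (cases s) (auto split: if_splits)
qed

lemma arc_points_nonneg:
  assumes "tangency a b" "s \<in> allowed a b" "0 \<le> a" "0 \<le> b" "0 \<le> b + disp_y s"
  shows "arc_points (lattice_point a b) s \<subseteq> {z. 0 \<le> Re z \<and> 0 \<le> Im z}"
proof
  fix z assume "z \<in> arc_points (lattice_point a b) s"
  then obtain t where t: "t \<in> closed_segment (start_angle s) (end_angle s)"
    and z: "z = arc_center (lattice_point a b) s + 2 * cis t"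
    by (auto simp: arc_points_def path_image_part_circlepath')
  have "Re z = of_int a + 2 * (cos t - cos (start_angle s))"
    by (simp add: z arc_center_def)
  then have "0 \<le> Re z" using cos_ge_start_angle[OF t] assms(3) by simp
  moreover have "0 \<le> Im z"
  proof -
    have Im: "Im z = sqrt 3 * of_int (b + center_y s) + 2 * sin t"
      by (simp add: z arc_center_lattice)
    have t': "t \<in> (if start_angle s \<le> end_angle s then {start_angle s..end_angle s}
        else {end_angle s..start_angle s})"
      using t by (simp add: closed_segment_eq_real_ivl)
    have nn: "0 \<le> sqrt 3 * real_of_int c" if "0 \<le> c" for c using that by simp
    show ?thesis
    proof (cases s)
      case Up
      then show ?thesis
        using t' sin_lower_bounds(1)[of t] nn[of b] assms by (simp add: Im)
    next
      case Flat
      then have "sqrt 3 \<le> 2 * sin t" using t' sin_lower_bounds(4)[of t] by simp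
      moreover have "Im z = sqrt 3 * of_int b - sqrt 3 + 2 * sin t"
        using Flat by (simp add: Im algebra_simps)
      ultimately show ?thesis using nn[OF assms(4)] by linarith
    next
      case Down
      then have "0 \<le> sin t" using t' sin_lower_bounds(1)[of t] pi_gt_zero
        by (auto split: if_splits)
      moreover have "Im z = sqrt 3 * of_int (b - 1) + 2 * sin t"
        using Down by (simp add: Im)
      moreover have "0 \<le> b - 1" using Down assms(5) by simp
      ultimately show ?thesis using nn[of "b - 1"] by linarith
    next
      case UpBar
      then have "- sqrt 3 \<le> 2 * sin t" using t' sin_lower_bounds(3)[of t] by simp
      moreover have "Im z = sqrt 3 * of_int b + sqrt 3 + 2 * sin t"
        using UpBar by (simp add: Im algebra_simps)
      ultimately show ?thesis using nn[OF assms(4)] by linarith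
    next
      case FlatBar
      then have "odd b" using assms(1,2) by (auto simp: allowed_def tangency_def split: if_splits)
      then have "1 \<le> b" using assms(4) by presburger
      then have "0 \<le> sqrt 3 * real_of_int (b - 1)" by (intro nn) simp
      moreover have "1 \<le> sqrt (3 :: real)" "- 1 \<le> sin t" by simp_all
      moreover have "Im z = sqrt 3 * of_int (b - 1) + 2 * sqrt 3 + 2 * sin t"
        using FlatBar by (simp add: Im algebra_simps)
      ultimately show ?thesis by linarith
    next
      case DownBar
      then have "- sqrt 3 \<le> 2 * sin t" using t' sin_lower_bounds(2)[of t] by simp
      moreover have "Im z = sqrt 3 * of_int (b - 1) + sqrt 3 + 2 * sin t"
        using DownBar by (simp add: Im algebra_simps)
      moreover have "0 \<le> b - 1" using DownBar assms(5) by simp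
      ultimately show ?thesis using nn[of "b - 1"] by linarith
    qed
  qed
  ultimately show "z \<in> {z. 0 \<le> Re z \<and> 0 \<le> Im z}" by simp
qed

lemma path_points_nonneg:
  assumes "tangency a b" "0 \<le> a" "on_packing (lattice_point a b) w"
    and "\<forall>k \<le> length w. 0 \<le> Im (endpoint (lattice_point a b) (take k w))"
  shows "path_points (lattice_point a b) w \<subseteq> {z. 0 \<le> Re z \<and> 0 \<le> Im z}"
  using assms
proof (induction w arbitrary: a b)
  case Nil
  then show ?case by simp
next
  case (Cons s w)
  let ?a = "a + disp_x s" and ?b = "b + disp_y s"
  have s: "s \<in> allowed a b" using Cons.prems by (simp add: arc_center_in_centers)
  have tail: "\<forall>k \<le> length w. 0 \<le> Im (endpoint (lattice_point ?a ?b) (take k w))"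
  proof (intro allI impI)
    fix k assume "k \<le> length w"
    then show "0 \<le> Im (endpoint (lattice_point ?a ?b) (take k w))"
      using Cons.prems(4)[rule_format, of "Suc k"] by (simp add: arc_end_lattice)
  qed
  have "0 \<le> b" using Cons.prems(4)[rule_format, of 0] by (simp add: zero_le_mult_iff)
  moreover have "0 \<le> ?b"
    using tail[rule_format, of 0]
    by (simp add: zero_le_mult_iff flip: of_int_add)
  ultimately have "arc_points (lattice_point a b) s \<subseteq> {z. 0 \<le> Re z \<and> 0 \<le> Im z}"
    using Cons.prems s by (intro arc_points_nonneg)
  moreover have "0 \<le> ?a" using Cons.prems(2) by (cases s) simp_all
  then have "path_points (lattice_point ?a ?b) w \<subseteq> {z. 0 \<le> Re z \<and> 0 \<le> Im z}"
    using tail Cons.prems tangency_step(1)[OF Cons.prems(1) s]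
    by (intro Cons.IH) (simp_all add: arc_end_lattice)
  ultimately show ?case by (simp add: arc_end_lattice)
qed

lemma path_in_packing_iff_word:
  "path_in_packing w \<longleftrightarrow>
     (w \<noteq> [] \<longrightarrow> hd w = Up) \<and> successively (\<lambda>s t. t \<in> follows s) w \<and>
     (\<forall>k \<le> length w. 0 \<le> Im (endpoint 0 (take k w)))"
proof -
  have 0: "(0 :: complex) = lattice_point 0 0" by (simp add: complex_eq_iff)
  have tang: "tangency 0 0" by (simp add: tangency_def)
  have all: "allowed 0 0 = {Up, DownBar}" by (simp add: allowed_def)
  have "path_in_packing w \<longleftrightarrow>
      on_packing 0 w \<and> (\<forall>k \<le> length w. 0 \<le> Im (endpoint 0 (take k w)))"
    unfolding path_in_packing_def
    using path_points_nonneg[OF tang, of w, folded 0] endpoint_in_path_points[of 0 _ w] by auto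
  moreover have "hd w \<noteq> DownBar"
    if "w \<noteq> []" "\<forall>k \<le> length w. 0 \<le> Im (endpoint 0 (take k w))"
  proof (cases w)
    case (Cons s v)
    then show ?thesis using that(2)[rule_format, of 1] by (auto simp: arc_end_eq)
  qed (use that in simp)
  ultimately show ?thesis
    using on_packing_iff[OF tang, of w, folded 0] by (auto simp: all)
qed

end

theory Submission
  imports Defs
begin

text \<open>The area is a sum of local weights: the circles under the path whose centres have a given
  abscissa can be charged to the step above them, because a path that passes above the top of a
  circle of the packing stays above the whole circle. The number of circles charged to a step depends
  only on its type and height. Hence the series counting the words from each height to the axis
  satisfy a linear system given by their first steps. It has a unique solution, since every step
  contributes a power of \<open>x\<close>, and a solution can be written down in terms of the tails of
  the continued fraction.\<close>

subsection \<open>Convergence of the continued fraction\<close>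

text \<open>An excursion above height 2*h alternates between two states at height 2*h+1: before
  \<open>Flat\<close> or \<open>UpBar\<close>, and before \<open>FlatBar\<close> or
  \<open>Down\<close>. The first state leads to the second by \<open>Flat\<close>, or by climbing,
  making excursions one level up and coming back; the second leads to the first by
  \<open>FlatBar\<close>, or the excursion ends. With q = x^4 y^(h+1) and T' the excursion series
  one level up, T = r / (1 - r) for r = q (1 + 1 / (1 - T')). This recursion does not have the shape
  of the claim. The substitution T = 2 K / (1 + K) brings it there: 1 + 1 / (1 - T') becomes 2 / (1
  - K'), and K = q / (1 - 3 q - K'). At the axis T itself is wanted, and 2 K / (1 + K) = 2 q / (1 -
  2 q - K'), hence the coefficients 2 in the top level and 3 in all others. In the geometry, several
  steps cover one circle although a single step is charged with it. That one high point of the path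
  forces the whole circle below it rests on the distance of at least 4 between centres.\<close>

lemma fps_X_power_dvd_iff:
  fixes f :: "'a::comm_ring_1 fps"
  shows "fps_X ^ n dvd f \<longleftrightarrow> (\<forall>i<n. fps_nth f i = 0)"
proof
  assume "fps_X ^ n dvd f"
  then show "\<forall>i<n. fps_nth f i = 0" by (auto simp: fps_X_power_mult_nth elim!: dvdE)
next
  assume "\<forall>i<n. fps_nth f i = 0"
  then have "f = fps_X ^ n * fps_shift n f" by (intro fps_ext) (simp add: fps_X_power_mult_nth)
  then show "fps_X ^ n dvd f" by (rule dvdI)
qed

lemma fps_eqI_dvd_diff:
  fixes f g :: "'a::comm_ring_1 fps"
  assumes "\<And>n. fps_X ^ n dvd f - g"
  shows "f = g"
proof (rule fps_ext)
  fix n show "fps_nth f n = fps_nth g n"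
    using assms[of "Suc n"] by (simp add: fps_X_power_dvd_iff del: power_Suc)
qed

lemma tendsto_fps_dvd_diffI:
  fixes f :: "'a::comm_ring_1 fps"
  assumes "\<And>n. fps_X ^ n dvd g n - f"
  shows "g \<longlonglongrightarrow> f"
proof (rule tendsto_fpsI)
  fix n
  have "fps_nth (g m) n = fps_nth f n" if "n < m" for m
    using assms[of m] that by (simp add: fps_X_power_dvd_iff)
  then show "\<forall>\<^sub>F m in sequentially. fps_nth (g m) n = fps_nth f n"
    by (rule eventually_mono[OF eventually_gt_at_top])
qed

lemma fps_divide_eqI:
  fixes f g h :: "rat fps fps"
  assumes "fps_nth g 0 = 1" "h * g = f"
  shows "f / g = h"
proof -
  have "f / g * g = h * g" using fps_divide_mult_cancel[OF assms(1)] assms(2) by simp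
  moreover have "g \<noteq> 0" using assms(1) by auto
  ultimately show ?thesis by simp
qed

lemma fps_divide_nth_0:
  fixes f g :: "rat fps fps"
  assumes "fps_nth g 0 = 1"
  shows "fps_nth (f / g) 0 = fps_nth f 0"
  using arg_cong[OF fps_divide_mult_cancel[OF assms, of f], of "\<lambda>h. fps_nth h 0"] assms by simp

text \<open>Multiplying by the unit \<open>g\<close> turns the difference of the quotients into
  \<open>f / h * (h - g)\<close>. A change of the denominator is thus multiplied by
  \<open>f / h\<close>, and a numerator divisible by \<open>X\<close> gains one order of
  precision.\<close>

lemma fps_divide_diff_dvd:
  fixes f g h :: "rat fps fps"
  assumes "fps_nth g 0 = 1" "fps_nth h 0 = 1" "k dvd f / h * (h - g)"
  shows "k dvd f / g - f / h"
proof -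
  have "(f / g - f / h) * g = f / h * (h - g)"
    using fps_divide_mult_cancel[OF assms(1), of f] fps_divide_mult_cancel[OF assms(2), of f]
    by (simp add: algebra_simps)
  moreover have "f / g - f / h = (1 / g) * ((f / g - f / h) * g)"
    using fps_divide_mult_cancel[OF assms(1), of 1]
    by (simp add: mult.assoc mult.commute[of _ g] mult.left_commute[of _ g])
  ultimately show ?thesis using assms(3) by (metis dvd_mult)
qed

section \<open>Truncated tails and their x-adic limit\<close>

definition circle_wt :: "nat \<Rightarrow> rat fps fps" where
  "circle_wt j = X ^ 4 * Y ^ j"

lemma circle_wt_nth_0 [simp]: "fps_nth (circle_wt j) 0 = 0"
  by (simp add: circle_wt_def)

lemma cf_tail_Suc: "cf_tail (Suc n) j = circle_wt j / (1 - 3 * circle_wt j - cf_tail n (Suc j))"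
  by (simp add: circle_wt_def mult.assoc)

lemma cf_tail_nth_0 [simp]: "fps_nth (cf_tail n j) 0 = 0"
  by (induction n arbitrary: j) (simp_all add: cf_tail_Suc fps_divide_nth_0 del: cf_tail.simps(2))

text \<open>One level of the continued fraction is an x-adic contraction, because its numerator has
  no constant coefficient.\<close>

lemma cf_level_diff_dvd:
  assumes "fps_nth a 0 = 0" "fps_nth b 0 = 0" "X ^ n dvd a - b"
  shows "X ^ Suc n dvd circle_wt j / (1 - 3 * circle_wt j - a) - circle_wt j / (1 - 3 * circle_wt j - b)"
proof (rule fps_divide_diff_dvd)
  have "X ^ 1 dvd circle_wt j / (1 - 3 * circle_wt j - b)"
    by (simp only: fps_X_power_dvd_iff) (simp add: fps_divide_nth_0 assms)
  then have "X ^ 1 * X ^ n dvd circle_wt j / (1 - 3 * circle_wt j - b) * (a - b)"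
    using assms(3) by (rule mult_dvd_mono)
  then show "X ^ Suc n dvd circle_wt j / (1 - 3 * circle_wt j - b)
      * ((1 - 3 * circle_wt j - b) - (1 - 3 * circle_wt j - a))"
    by simp
qed (simp_all add: assms)

lemma cf_tail_stable: "n \<le> m \<Longrightarrow> X ^ Suc n dvd cf_tail m j - cf_tail n j"
proof (induction n arbitrary: m j)
  case 0
  \<comment> \<open>All tails have constant coefficient 0, which supplies the first factor
    \<open>X\<close>.\<close>
  then show ?case by (simp only: fps_X_power_dvd_iff) simp
next
  case (Suc n)
  then obtain m' where m: "m = Suc m'" by (cases m) auto
  show ?case unfolding m cf_tail_Suc
    by (rule cf_level_diff_dvd) (use Suc m in simp_all)
qed

text \<open>A diagonal choice: by \<open>cf_tail_stable\<close>, the coefficient of index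
  \<open>i\<close> no longer changes from depth \<open>i\<close> on.\<close>

definition cf_lim :: "nat \<Rightarrow> rat fps fps" where
  "cf_lim j = Abs_fps (\<lambda>i. fps_nth (cf_tail i j) i)"

lemma cf_lim_nth_0 [simp]: "fps_nth (cf_lim j) 0 = 0"
  by (simp add: cf_lim_def)

lemma cf_tail_cf_lim_dvd: "X ^ Suc n dvd cf_tail n j - cf_lim j"
  unfolding fps_X_power_dvd_iff
proof (intro allI impI)
  fix i assume "i < Suc n"
  then show "fps_nth (cf_tail n j - cf_lim j) i = 0"
    using cf_tail_stable[of i n j] unfolding fps_X_power_dvd_iff by (simp add: cf_lim_def)
qed

lemma cf_tail_tendsto: "(\<lambda>n. cf_tail n j) \<longlonglongrightarrow> cf_lim j"
  by (rule tendsto_fps_dvd_diffI, rule power_le_dvd[OF cf_tail_cf_lim_dvd le_SucI[OF order_refl]])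

text \<open>Both sides are close to the same truncation: the left side as its limit, the right side
  because one level applied to a close tail stays close. The precision is arbitrary.\<close>

lemma cf_lim_rec: "cf_lim j = circle_wt j / (1 - 3 * circle_wt j - cf_lim (Suc j))"
proof (rule fps_eqI_dvd_diff)
  fix n
  let ?l = "\<lambda>a. circle_wt j / (1 - 3 * circle_wt j - a)"
  have "X ^ Suc (Suc n) dvd cf_tail (Suc n) j - cf_lim j" by (rule cf_tail_cf_lim_dvd)
  moreover have "X ^ Suc (Suc n) dvd cf_tail (Suc n) j - ?l (cf_lim (Suc j))"
    unfolding cf_tail_Suc by (rule cf_level_diff_dvd) (simp_all add: cf_tail_cf_lim_dvd del: power_Suc)
  ultimately have "X ^ Suc (Suc n) dvd
      (cf_tail (Suc n) j - ?l (cf_lim (Suc j))) - (cf_tail (Suc n) j - cf_lim j)"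
    by (rule dvd_diff[rotated])
  then have "X ^ Suc (Suc n) dvd cf_lim j - ?l (cf_lim (Suc j))" by simp
  then show "X ^ n dvd cf_lim j - ?l (cf_lim (Suc j))" by (rule power_le_dvd) simp
qed

lemma cf_lim_mult: "cf_lim j * (1 - 3 * circle_wt j - cf_lim (Suc j)) = circle_wt j"
  by (subst (1) cf_lim_rec) (simp add: fps_divide_mult_cancel)

lemma cf_top_tendsto:
  "(\<lambda>n. 1 / (1 - 2 * circle_wt 1 / (1 - 2 * circle_wt 1 - cf_tail n 2)))
     \<longlonglongrightarrow> 1 / (1 - 2 * circle_wt 1 / (1 - 2 * circle_wt 1 - cf_lim 2))"
proof (rule tendsto_fps_dvd_diffI)
  fix n
  let ?q = "circle_wt 1"
  have "X ^ n dvd cf_tail n 2 - cf_lim 2"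
    by (rule power_le_dvd[OF cf_tail_cf_lim_dvd le_SucI[OF order_refl]])
  then have "X ^ n dvd 2 * ?q / (1 - 2 * ?q - cf_tail n 2) - 2 * ?q / (1 - 2 * ?q - cf_lim 2)"
    by (intro fps_divide_diff_dvd) simp_all
  then show "X ^ n dvd 1 / (1 - 2 * ?q / (1 - 2 * ?q - cf_tail n 2)) - 1 / (1 - 2 * ?q / (1 - 2 * ?q - cf_lim 2))"
    by (intro fps_divide_diff_dvd dvd_mult) (simp_all add: fps_divide_nth_0)
qed

subsection \<open>A linear system solved by the continued fraction\<close>

text \<open>\<open>vertex_wt h\<close> counts the circles on the vertical line below a path vertex of height \<open>2 * h\<close>.\<close>

definition vertex_wt :: "nat \<Rightarrow> rat fps fps" where
  "vertex_wt h = Y ^ ((h + 1) div 2)"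

text \<open>The two rounded halves add up to \<open>Suc h\<close>. This is where the exponent of y
  at each level of the continued fraction comes from.\<close>

lemma vertex_wt_mult: "X ^ 4 * (vertex_wt h * vertex_wt (Suc h)) = circle_wt (Suc h)"
proof -
  have "(h + 1) div 2 + (Suc h + 1) div 2 = Suc h" by presburger
  then show ?thesis unfolding vertex_wt_def circle_wt_def by (simp flip: power_add)
qed

text \<open>First-step equations for the series of words that start at height \<open>2 * h\<close> (\<open>C\<close>), or at height
  \<open>2 * h + 1\<close> with next step \<open>Flat\<close> or \<open>UpBar\<close> (\<open>A\<close>), respectively \<open>FlatBar\<close> or \<open>Down\<close> (\<open>B\<close>).\<close>

definition height_system ::
  "(nat \<Rightarrow> rat fps fps) \<Rightarrow> (nat \<Rightarrow> rat fps fps) \<Rightarrow> (nat \<Rightarrow> rat fps fps) \<Rightarrow> bool" where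
  "height_system C A B \<longleftrightarrow> (\<forall>h.
     C h = (if h = 0 then 1 else X * vertex_wt h * B (h - 1)) + X * vertex_wt h * A h \<and>
     A h = X ^ 2 * vertex_wt (Suc h) * B h + X * C (Suc h) \<and>
     B h = X ^ 2 * vertex_wt h * A h + X * C h)"

text \<open>Every unknown on a right-hand side carries a factor \<open>X\<close>, so agreement
  modulo \<open>X ^ n\<close> improves to \<open>X ^ Suc n\<close>. The equations link neighbouring
  heights, so the induction treats all heights and all three families at once.\<close>

lemma height_system_unique:
  assumes "height_system C A B" "height_system C' A' B'"
  shows "C = C'"
proof -
  have "\<forall>h. X ^ n dvd C h - C' h \<and> X ^ n dvd A h - A' h \<and> X ^ n dvd B h - B' h" for n
  proof (induction n)
    case (Suc n)
    note eqs = assms[unfolded height_system_def]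
    have step: "X ^ Suc n dvd X * c * d" if "X ^ n dvd d" for c d
      using mult_dvd_mono[OF dvd_triv_left[of X c] that] by simp
    show ?case
    proof (intro allI conjI)
      fix h
      have "C h - C' h = (if h = 0 then 0 else X * vertex_wt h * (B (h - 1) - B' (h - 1)))
          + X * vertex_wt h * (A h - A' h)"
        by (subst (1) eqs(1)[THEN spec, THEN conjunct1], subst (1) eqs(2)[THEN spec, THEN conjunct1])
          (simp add: algebra_simps)
      then show "X ^ Suc n dvd C h - C' h"
        using step Suc.IH by (simp add: dvd_add)
      have "A h - A' h = X * (X * vertex_wt (Suc h)) * (B h - B' h) + X * 1 * (C (Suc h) - C' (Suc h))"
        unfolding eqs(1)[THEN spec, THEN conjunct2, THEN conjunct1, of h]
          eqs(2)[THEN spec, THEN conjunct2, THEN conjunct1, of h]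
        by (simp add: algebra_simps power2_eq_square)
      then show "X ^ Suc n dvd A h - A' h"
        using step Suc.IH by (simp only: dvd_add)
      have "B h - B' h = X * (X * vertex_wt h) * (A h - A' h) + X * 1 * (C h - C' h)"
        unfolding eqs(1)[THEN spec, THEN conjunct2, THEN conjunct2, of h]
          eqs(2)[THEN spec, THEN conjunct2, THEN conjunct2, of h]
        by (simp add: algebra_simps power2_eq_square)
      then show "X ^ Suc n dvd B h - B' h"
        using step Suc.IH by (simp only: dvd_add)
    qed
  qed simp
  then show ?thesis by (intro ext fps_eqI_dvd_diff) blast
qed

text \<open>The denominator of the excursion series
  \<open>2 * circle_wt (Suc h) / cf_denom h\<close>; for \<open>h = 0\<close> it is the second
  denominator of the claimed fraction.\<close>

definition cf_denom :: "nat \<Rightarrow> rat fps fps" where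
  "cf_denom h = 1 - 2 * circle_wt (Suc h) - cf_lim (h + 2)"

lemma cf_denom_nth_0 [simp]: "fps_nth (cf_denom h) 0 = 1"
  by (simp add: cf_denom_def)

text \<open>The relation T = 2 K / (1 + K) with denominators cleared; \<open>cf_denom h\<close>
  exceeds the denominator of K by one \<open>circle_wt (Suc h)\<close>.\<close>

lemma cf_lim_mult_denom: "cf_lim (Suc h) * cf_denom h = circle_wt (Suc h) * (1 + cf_lim (Suc h))"
  using cf_lim_mult[of "Suc h"] by (simp add: cf_denom_def algebra_simps)

text \<open>Eliminating \<open>A\<close> and \<open>B\<close> and writing \<open>T\<close> for the series of excursions above height \<open>2 * h\<close>
  gives \<open>T = 2 * K / (1 + K)\<close> with \<open>K\<close> the tail of index \<open>h + 1\<close>; the ratio of consecutive levels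
  below is read off from this.\<close>

fun level_sol :: "nat \<Rightarrow> rat fps fps" where
  "level_sol 0 = 1 / (1 - 2 * circle_wt 1 / cf_denom 0)"
| "level_sol (Suc h) = X ^ 2 * vertex_wt (Suc h) * (1 + cf_lim (h + 2)) / cf_denom h * level_sol h"

text \<open>Let K' be \<open>cf_lim (h + 2)\<close>. A word from height 2*h+2 makes excursions above
  that height, counted by (1 + K') / (1 - K'), and then descends. This expresses C at
  \<open>Suc h\<close> through B at \<open>h\<close>; the equations for A and B then make all three
  multiples of C at \<open>h\<close>, with common denominator \<open>cf_denom h\<close>.\<close>

lemma height_system_sol:
  "height_system level_sol
     (\<lambda>h. 2 * X ^ 3 * vertex_wt (Suc h) / cf_denom h * level_sol h)
     (\<lambda>h. X * (1 - cf_lim (h + 2)) / cf_denom h * level_sol h)"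
proof -
  let ?A = "\<lambda>h. 2 * X ^ 3 * vertex_wt (Suc h) / cf_denom h"
    and ?B = "\<lambda>h. X * (1 - cf_lim (h + 2)) / cf_denom h"
    and ?C = "\<lambda>h. X ^ 2 * vertex_wt (Suc h) * (1 + cf_lim (h + 2)) / cf_denom h"
  note c = fps_divide_mult_cancel[OF cf_denom_nth_0]
  have ne: "cf_denom h \<noteq> 0" for h using cf_denom_nth_0[of h] by (metis fps_zero_nth zero_neq_one)
  have A: "?A h = X ^ 2 * vertex_wt (Suc h) * ?B h + X * ?C h" for h
  proof -
    have "?A h * cf_denom h = (X ^ 2 * vertex_wt (Suc h) * ?B h + X * ?C h) * cf_denom h"
      unfolding distrib_right mult.assoc c by (simp add: algebra_simps power_numeral_reduce)
    then show ?thesis using ne by simp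
  qed
  have B: "?B h = X ^ 2 * vertex_wt h * ?A h + X" for h
  proof -
    have "?B h * cf_denom h = (X ^ 2 * vertex_wt h * ?A h + X) * cf_denom h"
      unfolding distrib_right mult.assoc c using vertex_wt_mult[of h]
      by (simp add: algebra_simps power_numeral_reduce cf_denom_def)
    then show ?thesis using ne by simp
  qed
  \<comment> \<open>\<open>X * vertex_wt h * ?A h\<close> is the excursion series T of level
    \<open>h\<close>.\<close>
  have AC: "X * vertex_wt h * ?A h * cf_denom h = 2 * circle_wt (Suc h)" for h
    unfolding mult.assoc c using vertex_wt_mult[of h]
    by (simp add: algebra_simps power_numeral_reduce)
  have C0: "level_sol 0 = 1 + X * vertex_wt 0 * ?A 0 * level_sol 0"
  proof -
    have "X * vertex_wt 0 * ?A 0 = 2 * circle_wt 1 / cf_denom 0"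
      using AC[of 0] by (intro fps_divide_eqI[symmetric]) simp_all
    moreover have "level_sol 0 * (1 - 2 * circle_wt 1 / cf_denom 0) = 1"
      unfolding level_sol.simps by (intro fps_divide_mult_cancel) (simp add: fps_divide_nth_0)
    ultimately show ?thesis by (simp add: algebra_simps del: level_sol.simps)
  qed
  have CS: "?C h = X * vertex_wt (Suc h) * ?B h + X * vertex_wt (Suc h) * ?A (Suc h) * ?C h" for h
  proof -
    let ?K = "cf_lim (h + 2)"
    have "X * vertex_wt (Suc h) * ?A (Suc h) * (1 + ?K) * cf_denom (Suc h)
        = (X * vertex_wt (Suc h) * ?A (Suc h) * cf_denom (Suc h)) * (1 + ?K)"
      by (simp only: mult_ac)
    also have "\<dots> = 2 * (circle_wt (Suc (Suc h)) * (1 + ?K))" unfolding AC by (simp only: mult.assoc)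
    also have "\<dots> = 2 * ?K * cf_denom (Suc h)" using cf_lim_mult_denom[of "Suc h"] by simp
    finally have "X * vertex_wt (Suc h) * ?A (Suc h) * (1 + ?K) * cf_denom (Suc h) = 2 * ?K * cf_denom (Suc h)" .
    \<comment> \<open>T (1 + K) = 2 K at level \<open>Suc h\<close>; the bracket in the next
      computation vanishes because (1 + K) - (1 - K) is also 2 K.\<close>
    then have t: "X * vertex_wt (Suc h) * ?A (Suc h) * (1 + ?K) = 2 * ?K" using ne by simp
    have "(?C h - X * vertex_wt (Suc h) * ?B h - X * vertex_wt (Suc h) * ?A (Suc h) * ?C h) * cf_denom h
      = X ^ 2 * vertex_wt (Suc h) * ((1 + ?K) - (1 - ?K) - X * vertex_wt (Suc h) * ?A (Suc h) * (1 + ?K))"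
      unfolding left_diff_distrib mult.assoc c by (simp add: algebra_simps power_numeral_reduce)
    also have "\<dots> = 0" unfolding t by simp
    finally have "?C h - X * vertex_wt (Suc h) * ?B h - X * vertex_wt (Suc h) * ?A (Suc h) * ?C h = 0"
      using ne by (simp only: mult_eq_0_iff) blast
    then show ?thesis by (simp only: diff_diff_eq right_minus_eq)
  qed
  show ?thesis
    unfolding height_system_def
  proof (intro allI conjI)
    fix h
    show "level_sol h = (if h = 0 then 1 else X * vertex_wt h * (?B (h - 1) * level_sol (h - 1)))
        + X * vertex_wt h * (?A h * level_sol h)"
    proof (cases h)
      case 0
      then show ?thesis using C0 by (simp add: mult.assoc del: level_sol.simps)
    next
      case (Suc k)
      have "level_sol (Suc k) = ?C k * level_sol k" by simp
      then show ?thesis using arg_cong[OF CS[of k], of "\<lambda>t. t * level_sol k"] Suc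
        by (simp add: distrib_right mult.assoc del: level_sol.simps)
    qed
    show "?A h * level_sol h = X ^ 2 * vertex_wt (Suc h) * (?B h * level_sol h) + X * level_sol (Suc h)"
      using arg_cong[OF A[of h], of "\<lambda>t. t * level_sol h"] by (simp add: distrib_right mult.assoc)
    show "?B h * level_sol h = X ^ 2 * vertex_wt h * (?A h * level_sol h) + X * level_sol h"
      using arg_cong[OF B[of h], of "\<lambda>t. t * level_sol h"] by (simp add: distrib_right mult.assoc)
  qed
qed

subsection \<open>Generating functions of words\<close>

text \<open>Heights are in units of sqrt 3, in which centres on a vertical line are 4 apart. The
  highest centre charged has ordinate \<open>b - 2\<close> below an even vertex,
  \<open>b - 1\<close> for \<open>Flat\<close> (the circle carrying the arc) and
  \<open>b - 3\<close> for \<open>FlatBar\<close> (the one below the carrying circle); adding 4 and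
  dividing by 4 counts them. \<open>UpBar\<close> and \<open>Down\<close> meet a line through
  centres only at their right end, which belongs to the next step.\<close>

fun step_wt :: "step \<Rightarrow> int \<Rightarrow> nat" where
  "step_wt Up b = nat ((b + 2) div 4)"
| "step_wt DownBar b = nat ((b + 2) div 4)"
| "step_wt Flat b = nat ((b + 3) div 4)"
| "step_wt FlatBar b = nat ((b + 1) div 4)"
| "step_wt _ b = 0"

fun word_wt :: "int \<Rightarrow> step list \<Rightarrow> nat" where
  "word_wt b [] = 0"
| "word_wt b (s # w) = step_wt s b + word_wt (b + disp_y s) w"

text \<open>The successor relation is carried as a state \<open>S\<close>, the admissible next
  steps, so that removing the first step leaves an object of the same kind.\<close>

fun word_from :: "step set \<Rightarrow> int \<Rightarrow> step list \<Rightarrow> bool" where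
  "word_from S b [] \<longleftrightarrow> b = 0"
| "word_from S b (s # w) \<longleftrightarrow> s \<in> S \<and> 0 \<le> b \<and> word_from (follows s) (b + disp_y s) w"

definition words :: "step set \<Rightarrow> int \<Rightarrow> nat \<Rightarrow> step list set" where
  "words S b n = {w. word_from S b w \<and> width w = real n}"

lemma finite_words: "finite (words S b n)"
  by (rule finite_subset[OF _ finite_width[of n]]) (auto simp: words_def)

definition word_gf :: "step set \<Rightarrow> int \<Rightarrow> rat fps fps" where
  "word_gf S b = Abs_fps (\<lambda>n. \<Sum>w\<in>words S b n. fps_X ^ word_wt b w)"

lemma word_gf_neg:
  assumes "b < 0"
  shows "word_gf S b = 0"
proof -
  have "\<not> word_from S b w" for w using assms by (cases w) auto
  then show ?thesis by (intro fps_ext) (simp add: word_gf_def words_def)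
qed

lemma finite_step_set: "finite (S :: step set)"
  by (rule finite_subset[of _ "{Up, Flat, Down, UpBar, FlatBar, DownBar}"])
    (use step.exhaust in auto)

lemma words_eq:
  assumes "0 \<le> b"
  shows "words S b n = {w. w = [] \<and> b = 0 \<and> n = 0} \<union>
    (\<Union>s\<in>S. if step_width s \<le> n then Cons s ` words (follows s) (b + disp_y s) (n - step_width s) else {})"
proof (intro equalityI subsetI)
  fix w assume w: "w \<in> words S b n"
  show "w \<in> {w. w = [] \<and> b = 0 \<and> n = 0} \<union>
    (\<Union>s\<in>S. if step_width s \<le> n then Cons s ` words (follows s) (b + disp_y s) (n - step_width s) else {})"
  proof (cases w)
    case Nil
    then show ?thesis using w by (simp add: words_def width_eq)
  next
    case (Cons s v)
    with w have sv: "s \<in> S" "word_from (follows s) (b + disp_y s) v"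
      "real (step_width s + sum_list (map step_width v)) = real n"
      by (auto simp: words_def width_eq)
    then have "step_width s + sum_list (map step_width v) = n" by (simp only: of_nat_eq_iff)
    then have "step_width s \<le> n" "v \<in> words (follows s) (b + disp_y s) (n - step_width s)"
      using sv by (auto simp: words_def width_eq)
    then show ?thesis using sv Cons by (intro UnI2 UN_I[of s]) auto
  qed
next
  fix w assume "w \<in> {w. w = [] \<and> b = 0 \<and> n = 0} \<union>
    (\<Union>s\<in>S. if step_width s \<le> n then Cons s ` words (follows s) (b + disp_y s) (n - step_width s) else {})"
  then consider "w = []" "b = 0" "n = 0"
    | s v where "s \<in> S" "step_width s \<le> n" "w = s # v"
      "v \<in> words (follows s) (b + disp_y s) (n - step_width s)"
    by (auto split: if_splits)
  then show "w \<in> words S b n"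
    using assms by cases (auto simp: words_def width_eq)
qed

lemma word_gf_rec:
  assumes "0 \<le> b"
  shows "word_gf S b = of_bool (b = 0) +
    (\<Sum>s\<in>S. X ^ step_width s * Y ^ step_wt s b * word_gf (follows s) (b + disp_y s))"
proof (rule fps_ext)
  fix n
  let ?T = "\<lambda>s. if step_width s \<le> n then Cons s ` words (follows s) (b + disp_y s) (n - step_width s) else {}"
  let ?f = "\<lambda>w. fps_X ^ word_wt b w :: rat fps"
  have T: "sum ?f (?T s) =
      fps_nth (X ^ step_width s * Y ^ step_wt s b * word_gf (follows s) (b + disp_y s)) n" for s
  proof -
    have "fps_nth (X ^ step_width s * Y ^ step_wt s b * word_gf (follows s) (b + disp_y s)) n
      = (if step_width s \<le> n then fps_X ^ step_wt s b *
          fps_nth (word_gf (follows s) (b + disp_y s)) (n - step_width s) else 0)"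
      by (simp add: mult.assoc fps_X_power_mult_nth)
    then show ?thesis
      by (simp add: word_gf_def sum.reindex sum_distrib_left power_add)
  qed
  have "fps_nth (word_gf S b) n = sum ?f ({w. w = [] \<and> b = 0 \<and> n = 0} \<union> (\<Union>s\<in>S. ?T s))"
    unfolding word_gf_def words_eq[OF assms, symmetric] by simp
  also have "\<dots> = sum ?f {w. w = [] \<and> b = 0 \<and> n = 0} + sum ?f (\<Union>s\<in>S. ?T s)"
    by (rule sum.union_disjoint) (auto simp: finite_step_set finite_words split: if_splits)
  also have "sum ?f (\<Union>s\<in>S. ?T s) = (\<Sum>s\<in>S. sum ?f (?T s))"
    by (rule sum.UNION_disjoint) (auto simp: finite_step_set finite_words split: if_splits)
  also have "sum ?f {w. w = [] \<and> b = 0 \<and> n = 0} = fps_nth (of_bool (b = 0)) n"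
    by (auto simp: of_bool_def)
  finally show "fps_nth (word_gf S b) n = fps_nth (of_bool (b = 0) +
    (\<Sum>s\<in>S. X ^ step_width s * Y ^ step_wt s b * word_gf (follows s) (b + disp_y s))) n"
    by (simp only: T fps_add_nth fps_sum_nth)
qed

lemma height_system_word_gf:
  "height_system (\<lambda>h. word_gf {Up, DownBar} (2 * int h))
     (\<lambda>h. word_gf {Flat, UpBar} (2 * int h + 1))
     (\<lambda>h. word_gf {FlatBar, Down} (2 * int h + 1))"
  unfolding height_system_def
proof (intro allI conjI)
  fix h :: nat
  have wt: "nat ((2 * int h + 2) div 4) = (h + 1) div 2" "nat ((2 * int h + 1 + 3) div 4) = (Suc h + 1) div 2"
    "nat ((2 * int h + 1 + 1) div 4) = (h + 1) div 2"
    by arith+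
  have C: "word_gf {Up, DownBar} b = of_bool (b = 0)
      + X * Y ^ nat ((b + 2) div 4) * word_gf {FlatBar, Down} (b - 1)
      + X * Y ^ nat ((b + 2) div 4) * word_gf {Flat, UpBar} (b + 1)" if "0 \<le> b" for b
    by (subst word_gf_rec[OF that]) (simp del: fps_const_power)
  show "word_gf {Up, DownBar} (2 * int h) =
      (if h = 0 then 1 else X * vertex_wt h * word_gf {FlatBar, Down} (2 * int (h - 1) + 1)) +
      X * vertex_wt h * word_gf {Flat, UpBar} (2 * int h + 1)"
  proof (cases h)
    case 0
    \<comment> \<open>On the axis \<open>DownBar\<close> leads to height -1, where the series
      vanishes; the summand 1 is the empty word.\<close>
    then show ?thesis by (subst C) (simp_all add: word_gf_neg vertex_wt_def)
  next
    case (Suc k)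
    then have "2 * int h - 1 = 2 * int (h - 1) + 1" "h \<noteq> 0" by simp_all
    then show ?thesis
      by (subst C) (simp_all only: wt vertex_wt_def, simp_all)
  qed
  have "word_gf {Flat, UpBar} b = X ^ 2 * Y ^ nat ((b + 3) div 4) * word_gf {FlatBar, Down} b
      + X * word_gf {Up, DownBar} (b + 1)" if "0 < b" for b
    using that by (subst word_gf_rec) (simp_all del: fps_const_power)
  from this[of "2 * int h + 1"]
  show "word_gf {Flat, UpBar} (2 * int h + 1) =
      X ^ 2 * vertex_wt (Suc h) * word_gf {FlatBar, Down} (2 * int h + 1) +
      X * word_gf {Up, DownBar} (2 * int (Suc h))"
    unfolding wt vertex_wt_def by (simp add: add.commute del: fps_const_power)
  have "word_gf {FlatBar, Down} b = X ^ 2 * Y ^ nat ((b + 1) div 4) * word_gf {Flat, UpBar} b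
      + X * word_gf {Up, DownBar} (b - 1)" if "0 < b" for b
    using that by (subst word_gf_rec) (simp_all del: fps_const_power)
  from this[of "2 * int h + 1"]
  show "word_gf {FlatBar, Down} (2 * int h + 1) =
      X ^ 2 * vertex_wt h * word_gf {Flat, UpBar} (2 * int h + 1) + X * word_gf {Up, DownBar} (2 * int h)"
    unfolding wt vertex_wt_def by (simp del: fps_const_power)
qed

lemma word_gf_cf:
  "word_gf {Up, DownBar} 0 = 1 / (1 - 2 * circle_wt 1 / (1 - 2 * circle_wt 1 - cf_lim 2))"
  using fun_cong[OF height_system_unique[OF height_system_word_gf height_system_sol], of 0]
  by (simp add: cf_denom_def numeral_2_eq_2)

section \<open>Packing paths as words\<close>

lemma word_from_iff:
  "word_from S b w \<longleftrightarrow> (w \<noteq> [] \<longrightarrow> hd w \<in> S) \<and> successively (\<lambda>s t. t \<in> follows s) w \<and>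
     (\<forall>k \<le> length w. 0 \<le> b + (\<Sum>s\<leftarrow>take k w. disp_y s)) \<and> b + (\<Sum>s\<leftarrow>w. disp_y s) = 0"
proof (induction w arbitrary: S b)
  case (Cons s w)
  have split: "(\<forall>k \<le> Suc (length w). P k) \<longleftrightarrow> P 0 \<and> (\<forall>k \<le> length w. P (Suc k))" for P
    using All_less_Suc2[of "Suc (length w)" P] by (simp only: less_Suc_eq_le)
  have "word_from S b (s # w) \<longleftrightarrow> s \<in> S \<and> 0 \<le> b \<and> (w \<noteq> [] \<longrightarrow> hd w \<in> follows s) \<and> successively (\<lambda>s t. t \<in> follows s) w \<and>
     (\<forall>k \<le> length w. 0 \<le> b + disp_y s + (\<Sum>s\<leftarrow>take k w. disp_y s)) \<and> b + disp_y s + (\<Sum>s\<leftarrow>w. disp_y s) = 0"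
    by (simp only: word_from.simps Cons.IH)
  then show ?case
    by (simp only: list.size add_Suc_right add_0_right split, cases "w = []")
      (simp_all add: successively_Cons add.assoc conj_ac)
qed auto

lemma Im_endpoint_0: "Im (endpoint 0 w) = sqrt 3 * real_of_int (\<Sum>s\<leftarrow>w. disp_y s)"
proof -
  have "Im (disp s) = sqrt 3 * real_of_int (disp_y s)" for s by (cases s) simp_all
  then show ?thesis unfolding endpoint_eq
    by (induction w) (simp_all add: distrib_left)
qed

text \<open>\<open>DownBar\<close> as a first step would leave the half plane at once. Admitting it
  makes the initial state the one that occurs at every even height.\<close>

lemma packing_path_iff: "packing_path w \<longleftrightarrow> word_from {Up, DownBar} 0 w"
proof -
  have "0 \<le> Im (endpoint 0 w) \<longleftrightarrow> 0 \<le> (\<Sum>s\<leftarrow>w. disp_y s)"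
    "Im (endpoint 0 w) = 0 \<longleftrightarrow> (\<Sum>s\<leftarrow>w. disp_y s) = 0" for w
    unfolding Im_endpoint_0 by (simp_all add: zero_le_mult_iff)
  moreover have "hd w \<noteq> DownBar"
    if "w \<noteq> []" "\<forall>k \<le> length w. 0 \<le> (\<Sum>s\<leftarrow>take k w. disp_y s)"
  proof (cases w)
    case (Cons s v)
    then show ?thesis using that(2)[rule_format, of 1] by auto
  qed (use that in simp)
  ultimately show ?thesis
    unfolding packing_path_def path_in_packing_iff_word word_from_iff by auto
qed

lemma packing_gf_eq:
  assumes "\<And>w. word_from {Up, DownBar} 0 w \<Longrightarrow> area w = word_wt 0 w"
  shows "packing_gf = word_gf {Up, DownBar} 0"
proof (intro fps_ext)
  fix n k
  let ?W = "words {Up, DownBar} 0 n"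
  have "{w. packing_path w \<and> width w = real n \<and> area w = k} = {w \<in> ?W. k = word_wt 0 w}"
    using assms by (auto simp: packing_path_iff words_def)
  then have "fps_nth (fps_nth packing_gf n) k = of_nat (card {w \<in> ?W. k = word_wt 0 w})"
    by (simp add: packing_gf_def)
  also have "\<dots> = (\<Sum>w\<in>?W. if k = word_wt 0 w then 1 else 0)"
    by (simp add: sum.If_cases finite_words Int_def)
  also have "\<dots> = fps_nth (fps_nth (word_gf {Up, DownBar} 0) n) k"
    by (simp add: word_gf_def fps_sum_nth)
  finally show "fps_nth (fps_nth packing_gf n) k = fps_nth (fps_nth (word_gf {Up, DownBar} 0) n) k" .
qed

subsection \<open>Circles under a path\<close>

lemma arc_points_iff:
  "z \<in> arc_points p s \<longleftrightarrow>
     (\<exists>t \<in> closed_segment (start_angle s) (end_angle s). z = arc_center p s + 2 * cis t)"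
  by (auto simp: arc_points_def path_image_part_circlepath')

lemma cos_le_end_angle:
  assumes "t \<in> closed_segment (start_angle s) (end_angle s)"
  shows "cos t \<le> cos (end_angle s)"
proof -
  have t: "t \<in> (if start_angle s \<le> end_angle s then {start_angle s..end_angle s}
      else {end_angle s..start_angle s})"
    using assms by (simp add: closed_segment_eq_real_ivl)
  have up: "cos t \<le> cos (end_angle s)" if "0 \<le> end_angle s" "end_angle s \<le> t" "t \<le> pi"
    using that by (intro cos_monotone_0_pi_le) auto
  have "cos (2 * pi - t) \<le> cos (2 * pi - end_angle s)"
    if "pi \<le> t" "t \<le> end_angle s" "end_angle s \<le> 2 * pi"
    using that by (intro cos_monotone_0_pi_le) auto
  then have low: "cos t \<le> cos (end_angle s)"
    if "pi \<le> t" "t \<le> end_angle s" "end_angle s \<le> 2 * pi"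
    using that by (simp add: cos_diff)
  show ?thesis using t up low pi_gt_zero by (cases s) (auto split: if_splits)
qed

definition upper_steps :: "step set" where
  "upper_steps = {Up, Flat, Down}"

lemma arc_points_bounds:
  assumes "z \<in> arc_points p s"
  shows "dist (arc_center p s) z = 2" "Re p \<le> Re z" "Re z \<le> Re (arc_end p s)"
    and "s \<in> upper_steps \<Longrightarrow> Im (arc_center p s) \<le> Im z"
    and "s \<notin> upper_steps \<Longrightarrow> Im z \<le> Im (arc_center p s)"
proof -
  obtain t where t: "t \<in> closed_segment (start_angle s) (end_angle s)"
    and z: "z = arc_center p s + 2 * cis t"
    using assms by (auto simp: arc_points_iff)
  show "dist (arc_center p s) z = 2" by (simp add: z dist_norm norm_mult)
  show "Re p \<le> Re z" using cos_ge_start_angle[OF t] by (simp add: z arc_center_def)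
  show "Re z \<le> Re (arc_end p s)" using cos_le_end_angle[OF t] by (simp add: z arc_end_def)
  have t': "t \<in> (if start_angle s \<le> end_angle s then {start_angle s..end_angle s}
      else {end_angle s..start_angle s})"
    using t by (simp add: closed_segment_eq_real_ivl)
  show "Im (arc_center p s) \<le> Im z" if "s \<in> upper_steps"
  proof -
    have "0 \<le> t" "t \<le> pi"
      using that t' pi_gt_zero by (cases s; auto simp: upper_steps_def split: if_splits)+
    then show ?thesis by (simp add: z sin_ge_zero)
  qed
  show "Im z \<le> Im (arc_center p s)" if "s \<notin> upper_steps"
  proof -
    have "pi \<le> t" "t \<le> 2 * pi"
      using that t' pi_gt_zero by (cases s; auto simp: upper_steps_def split: if_splits)+
    then show ?thesis using sin_le_zero[of t] by (cases "t = 2 * pi") (auto simp: z)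
  qed
qed

text \<open>Intermediate values: the arc is connected, hence so is its set of abscissas.\<close>

lemma arc_points_cover:
  assumes "Re p \<le> x" "x \<le> Re (arc_end p s)"
  shows "\<exists>v \<in> arc_points p s. Re v = x"
proof -
  have "connected (Re ` arc_points p s)"
    unfolding arc_points_def
    by (intro connected_continuous_image continuous_intros connected_path_image) simp
  moreover have "p \<in> arc_points p s" "arc_end p s \<in> arc_points p s"
    unfolding arc_points_iff
    by (rule bexI[of _ "start_angle s"], simp_all add: arc_center_def)
      (rule bexI[of _ "end_angle s"], simp_all add: arc_end_def arc_center_def)
  then have "Re p \<in> Re ` arc_points p s" "Re (arc_end p s) \<in> Re ` arc_points p s" by simp_all
  ultimately have "x \<in> Re ` arc_points p s" using assms by (rule connectedD_interval)
  then show ?thesis by auto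
qed

section \<open>Comparison of two circles of the packing\<close>

text \<open>The squared distance is 16 times the form m^2 + m k + k^2 of the hexagonal lattice.
  Completing the square shows that the form is positive definite, and a positive integer is at least
  1.\<close>

lemma centers_dist:
  assumes "c \<in> centers" "c' \<in> centers" "c \<noteq> c'"
  shows "4 \<le> dist c c'"
proof -
  obtain i j i' j' :: int where c: "c = Complex (2 + 4 * of_int i + 2 * of_int j) (2 * sqrt 3 * of_int j)"
    and c': "c' = Complex (2 + 4 * of_int i' + 2 * of_int j') (2 * sqrt 3 * of_int j')"
    using assms by (auto simp: centers_def)
  define m k where "m = i - i'" and "k = j - j'"
  have "m \<noteq> 0 \<or> k \<noteq> 0" using assms(3) c c' by (auto simp: m_def k_def)
  then have "0 < (2 * m + k)\<^sup>2 + 3 * k\<^sup>2"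
    by (cases "k = 0") (auto intro: add_nonneg_pos)
  moreover have "(2 * m + k)\<^sup>2 + 3 * k\<^sup>2 = 4 * (m\<^sup>2 + m * k + k\<^sup>2)"
    by (simp add: power2_eq_square algebra_simps)
  ultimately have "0 < m\<^sup>2 + m * k + k\<^sup>2" by simp
  then have "1 \<le> m\<^sup>2 + m * k + k\<^sup>2" by (simp only: int_one_le_iff_zero_less)
  then have "(1::real) \<le> of_int (m\<^sup>2 + m * k + k\<^sup>2)" by (simp only: of_int_1_le_iff)
  moreover have "(dist c c')\<^sup>2 = 16 * of_int (m\<^sup>2 + m * k + k\<^sup>2)"
  proof -
    have "c - c' = Complex (4 * of_int m + 2 * of_int k) (2 * sqrt 3 * of_int k)"
      by (simp add: c c' m_def k_def complex_eq_iff algebra_simps)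
    then have "(dist c c')\<^sup>2 = (4 * of_int m + 2 * of_int k)\<^sup>2 + (2 * sqrt 3 * of_int k)\<^sup>2"
      unfolding dist_norm cmod_power2 by simp
    then show ?thesis by (simp add: power2_eq_square algebra_simps)
  qed
  ultimately have "4\<^sup>2 \<le> (dist c c')\<^sup>2" by simp
  then show ?thesis by (rule power2_le_imp_le) simp
qed

text \<open>Two vectors of length 2 differ by at most 4, so if the claim failed, the centres would be
  less than 4 apart.\<close>

lemma upper_circle_above:
  assumes "4 \<le> dist c c'" "Im c \<le> Im c'" "dist c z = 2" "dist c' v = 2" "Re v = Re z"
  shows "Im z \<le> Im v"
proof (rule ccontr)
  assume "\<not> Im z \<le> Im v"
  then have "(Im c' - Im c)\<^sup>2 < (Im c' - Im c + (Im z - Im v))\<^sup>2"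
    using assms(2) by (intro power_strict_mono) auto
  then have "(cmod (c' - c))\<^sup>2 < (cmod ((z - c) - (v - c')))\<^sup>2"
    using assms(5) unfolding cmod_power2 by (simp add: algebra_simps)
  then have "cmod (c' - c) < cmod ((z - c) - (v - c'))" by (rule power2_less_imp_less) simp
  also have "\<dots> \<le> cmod (z - c) + cmod (v - c')" by (rule norm_triangle_ineq4)
  also have "\<dots> = 4" using assms(3,4) by (simp add: dist_norm norm_minus_commute)
  finally show False using assms(1) by (simp add: dist_norm norm_minus_commute)
qed

text \<open>\<open>circle_under\<close> localised to one abscissa, so that different steps can
  account for different parts of the circle.\<close>

definition covered :: "complex \<Rightarrow> complex set \<Rightarrow> real \<Rightarrow> bool" where
  "covered c P x \<longleftrightarrow> (\<forall>z \<in> sphere c 2. Re z = x \<longrightarrow> (\<exists>v \<in> P. Re v = x \<and> Im z \<le> Im v))"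

lemma covered_mono: "covered c P x \<Longrightarrow> P \<subseteq> Q \<Longrightarrow> covered c Q x"
  unfolding covered_def by blast

lemma circle_under_iff_covered:
  "circle_under c w \<longleftrightarrow> (\<forall>x \<in> {Re c - 2..Re c + 2}. covered c (path_points 0 w) x)"
proof -
  have Re: "Re z \<in> {Re c - 2..Re c + 2}" if "z \<in> sphere c 2" for z
  proof -
    have "\<bar>Re (c - z)\<bar> \<le> 2" using that abs_Re_le_cmod[of "c - z"] by (simp add: dist_norm)
    then show ?thesis by (simp add: abs_le_iff)
  qed
  show ?thesis unfolding circle_under_def covered_def
  proof (intro iffI ballI impI)
    fix z assume "\<forall>x\<in>{Re c - 2..Re c + 2}. \<forall>z\<in>sphere c 2. Re z = x \<longrightarrow>
      (\<exists>v\<in>path_points 0 w. Re v = x \<and> Im z \<le> Im v)" and z: "z \<in> sphere c 2"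
    from bspec[OF bspec[OF this(1) Re[OF z]] z]
    show "\<exists>v\<in>path_points 0 w. Re v = Re z \<and> Im z \<le> Im v" by simp
  qed auto
qed

lemma lattice_point_inject [simp]: "lattice_point a b = lattice_point a' b' \<longleftrightarrow> a = a' \<and> b = b'"
  by (simp add: complex_eq_iff)

text \<open>If the arc lies on another circle, the centres are at least 4 apart and
  \<open>upper_circle_above\<close> applies. If it lies on the circle itself, it is on the upper
  half, and points of one circle with equal abscissa agree or are mirror images in the horizontal
  line through the centre.\<close>

lemma arc_covers:
  assumes ab: "tangency a b" "s \<in> allowed a b"
    and c: "lattice_point e \<beta> \<in> centers"
    and above: "\<beta> \<le> b + center_y s" "\<beta> = b + center_y s \<Longrightarrow> s \<in> upper_steps"
    and x: "of_int a \<le> x" "x \<le> of_int (a + disp_x s)"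
  shows "covered (lattice_point e \<beta>) (arc_points (lattice_point a b) s) x"
proof -
  let ?p = "lattice_point a b"
  obtain v where v: "v \<in> arc_points ?p s" "Re v = x"
    using arc_points_cover[of ?p x s] x unfolding arc_end_lattice lattice_point_simps by blast
  note bounds = arc_points_bounds[OF v(1)]
  show ?thesis unfolding covered_def
  proof (intro ballI impI bexI[OF _ v(1)] conjI v(2))
    fix z assume z: "z \<in> sphere (lattice_point e \<beta>) 2" "Re z = x"
    show "Im z \<le> Im v"
    proof (cases "arc_center ?p s = lattice_point e \<beta>")
      case False
      have "arc_center ?p s \<in> centers" using ab by (simp add: arc_center_in_centers)
      then have "4 \<le> dist (lattice_point e \<beta>) (arc_center ?p s)"
        by (rule centers_dist[OF c]) (use False in auto)
      moreover have "Im (lattice_point e \<beta>) \<le> Im (arc_center ?p s)"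
        using above(1) by (simp add: arc_center_lattice del: of_int_add)
      ultimately show ?thesis
        by (rule upper_circle_above) (use bounds(1) z v(2) in auto)
    next
      case True
      then have "Im (arc_center ?p s) \<le> Im v"
        using above(2) bounds(4) by (simp add: arc_center_lattice)
      moreover have "(cmod (z - lattice_point e \<beta>))\<^sup>2 = (cmod (v - lattice_point e \<beta>))\<^sup>2"
        using bounds(1) z True by (simp add: dist_norm norm_minus_commute)
      then have "(Im z - sqrt 3 * \<beta>)\<^sup>2 = (Im v - sqrt 3 * \<beta>)\<^sup>2"
        using z v unfolding cmod_power2 by simp
      ultimately show ?thesis
        using True by (auto simp: power2_eq_iff mult.commute)
    qed
  qed
qed

section \<open>Covering a circle by the steps around a vertex\<close>

lemma path_points_append:
  "path_points p (u @ v) = path_points p u \<union> path_points (endpoint p u) v"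
  using endpoint_in_path_points[of _ 0] by (induction u arbitrary: p) auto

abbreviation total_x :: "step list \<Rightarrow> int" where "total_x u \<equiv> \<Sum>s\<leftarrow>u. disp_x s"
abbreviation total_y :: "step list \<Rightarrow> int" where "total_y u \<equiv> \<Sum>s\<leftarrow>u. disp_y s"

lemma word_from_append:
  assumes "tangency a b" "word_from (allowed a b) b (u @ v)"
  shows "tangency (a + total_x u) (b + total_y u)"
    and "word_from (allowed (a + total_x u) (b + total_y u)) (b + total_y u) v"
    and "endpoint (lattice_point a b) u = lattice_point (a + total_x u) (b + total_y u)"
  using assms
proof (induction u arbitrary: a b)
  case (Cons s u)
  {
    case 1
    then show ?case using Cons.IH(1)[OF tangency_step(1)[of a b s]] tangency_step(2)[of a b s]
      by (simp add: add.assoc)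
  next
    case 2
    then show ?case using Cons.IH(2)[OF tangency_step(1)[of a b s]] tangency_step(2)[of a b s]
      by (simp add: add.assoc)
  next
    case 3
    then show ?case using Cons.IH(3)[OF tangency_step(1)[of a b s]] tangency_step(2)[of a b s]
      by (simp add: add.assoc arc_end_lattice)
  }
qed simp_all

lemma step_bounds:
  "-1 \<le> center_y s" "center_y s = -1 \<Longrightarrow> s \<in> upper_steps"
  "disp_y s \<le> center_y s + 1" "center_y s = disp_y s - 1 \<Longrightarrow> s \<in> upper_steps"
  "-1 \<le> disp_y s" "disp_y s \<le> 1" "disp_x s = 1 \<or> disp_x s = 2"
  by (cases s; simp add: upper_steps_def)+

text \<open>The suffix is the horizontal distance from the centre to the vertex. A step is at least
  1 wide, so the step leaving the vertex reaches the right end of the circle; there is one because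
  the height is positive.\<close>

lemma covers_right_1:
  assumes "tangency a b" "word_from (allowed a b) b w"
    and "lattice_point e \<beta> \<in> centers" "0 \<le> \<beta>" "a = e + 1" "\<beta> + 1 \<le> b"
    and "of_int (e + 1) \<le> x" "x \<le> of_int (e + 2)"
  shows "covered (lattice_point e \<beta>) (path_points (lattice_point a b) w) x"
proof (cases w)
  case (Cons s v)
  then have s: "s \<in> allowed a b" using assms(2) by simp
  have "covered (lattice_point e \<beta>) (arc_points (lattice_point a b) s) x"
  proof (rule arc_covers[OF assms(1) s assms(3)])
    show "\<beta> \<le> b + center_y s" using step_bounds(1)[of s] assms(6) by linarith
    show "s \<in> upper_steps" if "\<beta> = b + center_y s"
      by (rule step_bounds(2)) (use step_bounds(1)[of s] assms(6) that in linarith)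
    show "of_int a \<le> x" "x \<le> of_int (a + disp_x s)"
      using step_bounds(7)[of s] assms(5,7,8) by auto
  qed
  then show ?thesis by (rule covered_mono) (simp add: Cons)
qed (use assms in simp)

text \<open>The vertex lies above the top of the circle. A first step of width 1 lowers it by at
  most one unit, which leaves the height needed in \<open>covers_right_1\<close>.\<close>

lemma covers_right_0:
  assumes "tangency a b" "word_from (allowed a b) b w"
    and "lattice_point a \<beta> \<in> centers" "0 \<le> \<beta>" "\<beta> + 2 \<le> b"
    and "of_int a \<le> x" "x \<le> of_int (a + 2)"
  shows "covered (lattice_point a \<beta>) (path_points (lattice_point a b) w) x"
proof (cases w)
  case (Cons s v)
  then have s: "s \<in> allowed a b" using assms(2) by simp
  show ?thesis
  proof (cases "x \<le> of_int (a + disp_x s)")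
    case True
    \<comment> \<open>The centre of the arc is strictly higher than that of the circle, so the case
      of equal ordinates is void.\<close>
    have "covered (lattice_point a \<beta>) (arc_points (lattice_point a b) s) x"
      using step_bounds(1)[of s] assms(5)
      by (intro arc_covers[OF assms(1) s assms(3) _ _ assms(6) True]) linarith+
    then show ?thesis by (rule covered_mono) (simp add: Cons)
  next
    case False
    then have 1: "disp_x s = 1" using assms(7) step_bounds(7)[of s] by auto
    have "covered (lattice_point a \<beta>) (path_points (lattice_point (a + disp_x s) (b + disp_y s)) v) x"
    proof (rule covers_right_1)
      show "tangency (a + disp_x s) (b + disp_y s)" using tangency_step(1) assms(1) s by blast
      show "word_from (allowed (a + disp_x s) (b + disp_y s)) (b + disp_y s) v"
        using tangency_step(2)[OF assms(1) s] assms(2) Cons by simp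
      show "\<beta> + 1 \<le> b + disp_y s" using assms(5) step_bounds(5)[of s] by linarith
      show "a + disp_x s = a + 1" "of_int (a + 1) \<le> x" using 1 False by simp_all
    qed (fact assms)+
    then show ?thesis by (rule covered_mono) (simp add: Cons arc_end_lattice)
  qed
qed (use assms in simp)

lemma origin_lattice: "(0 :: complex) = lattice_point 0 0"
  by (simp add: complex_eq_iff)

lemma origin_tangency: "tangency 0 0" "allowed 0 0 = {Up, DownBar}"
  by (simp_all add: tangency_def allowed_def)

text \<open>The mirror image of \<open>covers_right_1\<close>: the last step of the prefix
  \<open>u\<close>, ending at the vertex, covers the outer part on the left.\<close>

lemma covers_left_1:
  assumes w: "word_from {Up, DownBar} 0 (u @ v)"
    and c: "lattice_point e \<beta> \<in> centers" "0 \<le> \<beta>" "total_x u = e - 1" "\<beta> + 1 \<le> total_y u"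
    and x: "of_int (e - 2) \<le> x" "x \<le> of_int (e - 1)"
  shows "covered (lattice_point e \<beta>) (path_points 0 (u @ v)) x"
proof (cases u rule: rev_cases)
  case (snoc u' s)
  let ?a = "total_x u'" and ?b = "total_y u'"
  have w': "word_from (allowed 0 0) 0 (u' @ (s # v))" using w snoc by (simp add: origin_tangency)
  note pos = word_from_append[OF origin_tangency(1) w', unfolded add_0]
  have "covered (lattice_point e \<beta>) (arc_points (lattice_point ?a ?b) s) x"
    by (rule arc_covers) (use pos c x snoc in \<open>cases s; auto simp: upper_steps_def\<close>)+
  then show ?thesis
    by (rule covered_mono) (use pos(3) snoc in \<open>auto simp: path_points_append simp flip: origin_lattice\<close>)
qed (use c in simp)

lemma covers_left_0:
  assumes w: "word_from {Up, DownBar} 0 (u @ v)"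
    and c: "lattice_point e \<beta> \<in> centers" "0 \<le> \<beta>" "total_x u = e" "\<beta> + 2 \<le> total_y u"
    and x: "of_int (e - 2) \<le> x" "x \<le> of_int e"
  shows "covered (lattice_point e \<beta>) (path_points 0 (u @ v)) x"
proof (cases u rule: rev_cases)
  case (snoc u' s)
  let ?a = "total_x u'" and ?b = "total_y u'"
  have w': "word_from (allowed 0 0) 0 (u' @ (s # v))" using w snoc by (simp add: origin_tangency)
  note pos = word_from_append[OF origin_tangency(1) w', unfolded add_0]
  show ?thesis
  proof (cases "of_int ?a \<le> x")
    case True
    have "covered (lattice_point e \<beta>) (arc_points (lattice_point ?a ?b) s) x"
      by (rule arc_covers) (use pos c x snoc True in \<open>cases s; auto simp: upper_steps_def\<close>)+
    then show ?thesis
      by (rule covered_mono) (use pos(3) snoc in \<open>auto simp: path_points_append simp flip: origin_lattice\<close>)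
  next
    case False
    then have "disp_x s = 1" using x c(3) snoc by (cases s) auto
    moreover have "\<beta> + 1 \<le> total_y u'" using c(4) snoc by (cases s) auto
    ultimately have "covered (lattice_point e \<beta>) (path_points 0 (u' @ (s # v))) x"
      using w' c x snoc False by (intro covers_left_1) (auto simp: origin_tangency)
    then show ?thesis using snoc by simp
  qed
qed (use c in simp)

section \<open>Circles charged to the steps\<close>

definition circles_below :: "int \<Rightarrow> int \<Rightarrow> complex set" where
  "circles_below e h = lattice_point e ` {\<beta>. lattice_point e \<beta> \<in> centers \<and> 0 \<le> \<beta> \<and> \<beta> \<le> h}"

text \<open>The hypotheses place \<open>h\<close> in the residue class of the ordinates of centres,
  so these are enumerated from \<open>h\<close> downwards in steps of 4.\<close>

lemma circles_below_eq:
  assumes "even h" "(e - h) mod 4 = 2"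
  shows "circles_below e h = (\<lambda>k. lattice_point e (h - 4 * int k)) ` {..<nat ((h + 4) div 4)}"
proof -
  have "{\<beta>. even \<beta> \<and> (e - \<beta>) mod 4 = 2 \<and> 0 \<le> \<beta> \<and> \<beta> \<le> h}
      = (\<lambda>k. h - 4 * int k) ` {..<nat ((h + 4) div 4)}" (is "?L = ?R")
  proof (intro equalityI subsetI)
    fix \<beta> assume "\<beta> \<in> ?L"
    then have "\<beta> = h - 4 * ((h - \<beta>) div 4)" "(h - \<beta>) div 4 < (h + 4) div 4" "0 \<le> (h - \<beta>) div 4"
      using assms by (simp, presburger)+
    then show "\<beta> \<in> ?R" by (intro image_eqI[of _ _ "nat ((h - \<beta>) div 4)"]) auto
  next
    fix \<beta> assume "\<beta> \<in> ?R"
    then obtain k where k: "\<beta> = h - 4 * int k" "int k < (h + 4) div 4" by auto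
    then have "even \<beta>" "(e - \<beta>) mod 4 = 2" "0 \<le> \<beta>" "\<beta> \<le> h"
      using assms by presburger+
    then show "\<beta> \<in> ?L" by simp
  qed
  then show ?thesis by (simp add: circles_below_def lattice_point_in_centers image_image conj_assoc)
qed

lemma card_circles_below:
  assumes "even h" "(e - h) mod 4 = 2"
  shows "finite (circles_below e h)" "card (circles_below e h) = nat ((h + 4) div 4)"
  unfolding circles_below_eq[OF assms] by (simp_all add: card_image inj_on_def)

text \<open>A circle lying under the path is charged to the step that meets the vertical line through
  its centre; at even heights, where two steps meet, to the right one.\<close>

fun step_circles :: "step \<Rightarrow> int \<Rightarrow> int \<Rightarrow> complex set" where
  "step_circles Up a b = circles_below a (b - 2)"
| "step_circles DownBar a b = circles_below a (b - 2)"
| "step_circles Flat a b = circles_below (a + 1) (b - 1)"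
| "step_circles FlatBar a b = circles_below (a + 1) (b - 3)"
| "step_circles _ a b = {}"

fun word_circles :: "int \<Rightarrow> int \<Rightarrow> step list \<Rightarrow> complex set" where
  "word_circles a b [] = {}"
| "word_circles a b (s # w) = step_circles s a b \<union> word_circles (a + disp_x s) (b + disp_y s) w"

lemma allowed_iff:
  "Up \<in> allowed a b \<longleftrightarrow> (a - b) mod 4 = 0 \<and> even b"
  "DownBar \<in> allowed a b \<longleftrightarrow> (a - b) mod 4 = 0 \<and> even b"
  "Flat \<in> allowed a b \<longleftrightarrow> (a - b) mod 4 = 0 \<and> odd b"
  "UpBar \<in> allowed a b \<longleftrightarrow> (a - b) mod 4 = 0 \<and> odd b"
  "tangency a b \<Longrightarrow> FlatBar \<in> allowed a b \<longleftrightarrow> (a - b) mod 4 = 2 \<and> odd b"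
  "tangency a b \<Longrightarrow> Down \<in> allowed a b \<longleftrightarrow> (a - b) mod 4 = 2 \<and> odd b"
  by (auto simp: allowed_def tangency_def split: if_splits)

lemma card_step_circles:
  assumes "tangency a b" "s \<in> allowed a b"
  shows "finite (step_circles s a b)" "card (step_circles s a b) = step_wt s b"
proof -
  have "finite (step_circles s a b) \<and> card (step_circles s a b) = step_wt s b"
  proof (cases s)
    case Up
    then have "(a - b) mod 4 = 0 \<and> even b"
      using assms by (simp add: allowed_iff)
    then have "even (b - 2)" "(a - (b - 2)) mod 4 = 2" by presburger+
    then show ?thesis using card_circles_below Up by (simp add: algebra_simps)
  next
    case DownBar
    then have "(a - b) mod 4 = 0 \<and> even b"
      using assms by (simp add: allowed_iff)
    then have "even (b - 2)" "(a - (b - 2)) mod 4 = 2" by presburger+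
    then show ?thesis using card_circles_below DownBar by (simp add: algebra_simps)
  next
    case Flat
    then have "(a - b) mod 4 = 0 \<and> odd b"
      using assms by (simp add: allowed_iff)
    then have "even (b - 1)" "(a + 1 - (b - 1)) mod 4 = 2" by presburger+
    then show ?thesis using card_circles_below[of "b - 1" "a + 1"] Flat by (simp add: algebra_simps)
  next
    case FlatBar
    then have "(a - b) mod 4 = 2 \<and> odd b"
      using assms by (simp add: allowed_iff)
    then have "even (b - 3)" "(a + 1 - (b - 3)) mod 4 = 2" by presburger+
    then show ?thesis using card_circles_below[of "b - 3" "a + 1"] FlatBar by (simp add: algebra_simps)
  qed auto
  then show "finite (step_circles s a b)" "card (step_circles s a b) = step_wt s b" by auto
qed

text \<open>The range is half open, so the sets charged to different steps are disjoint and their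
  cardinalities add up.\<close>

lemma step_circles_Re: "c \<in> step_circles s a b \<Longrightarrow> of_int a \<le> Re c \<and> Re c < of_int (a + disp_x s)"
  by (cases s) (auto simp: circles_below_def)

lemma word_circles_Re: "c \<in> word_circles a b w \<Longrightarrow> of_int a \<le> Re c"
proof (induction w arbitrary: a b)
  case (Cons s w)
  have "0 \<le> disp_x s" by (cases s) auto
  then show ?case using Cons step_circles_Re[of c s a b] by fastforce
qed simp

lemma card_word_circles:
  assumes "tangency a b" "word_from (allowed a b) b w"
  shows "finite (word_circles a b w) \<and> card (word_circles a b w) = word_wt b w"
  using assms
proof (induction w arbitrary: a b)
  case (Cons s w)
  then have s: "s \<in> allowed a b" by simp
  have "finite (word_circles (a + disp_x s) (b + disp_y s) w) \<and>
      card (word_circles (a + disp_x s) (b + disp_y s) w) = word_wt (b + disp_y s) w"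
    using Cons.prems tangency_step[OF Cons.prems(1) s] by (intro Cons.IH) auto
  moreover have "step_circles s a b \<inter> word_circles (a + disp_x s) (b + disp_y s) w = {}"
    using step_circles_Re[of _ s a b] word_circles_Re[of _ "a + disp_x s" "b + disp_y s" w]
    by (metis disjoint_iff not_le)
  ultimately show ?case
    using card_step_circles[OF Cons.prems(1) s] by (simp add: card_Un_disjoint)
qed simp

lemma word_circles_split:
  assumes "c \<in> word_circles a b w"
  shows "\<exists>u s v. w = u @ s # v \<and> c \<in> step_circles s (a + total_x u) (b + total_y u)"
  using assms
proof (induction w arbitrary: a b)
  case (Cons s w)
  show ?case
  proof (cases "c \<in> step_circles s a b")
    case True
    then show ?thesis by (intro exI[of _ "[]"]) simp
  next
    case False
    then have "c \<in> word_circles (a + disp_x s) (b + disp_y s) w" using Cons.prems by simp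
    from Cons.IH[OF this] obtain u t v where "w = u @ t # v"
      "c \<in> step_circles t (a + disp_x s + total_x u) (b + disp_y s + total_y u)"
      by (elim exE conjE)
    then show ?thesis by (intro exI[of _ "s # u"] exI[of _ t] exI[of _ v]) (simp add: add.assoc)
  qed
qed simp

section \<open>Charged circles and circles under the path\<close>

text \<open>Below a vertex, the circle splits into a left and a right half. Below a flat step, the
  step covers the middle, and its two ends are vertices at distance 1 for the outer parts.\<close>

lemma word_circles_under:
  assumes w: "word_from {Up, DownBar} 0 w" and "c \<in> word_circles 0 0 w"
  shows "c \<in> centers \<and> 0 \<le> Im c \<and> circle_under c w"
proof -
  obtain u s v where usv: "w = u @ s # v" and c: "c \<in> step_circles s (total_x u) (total_y u)"
    using word_circles_split[OF assms(2), unfolded add_0] by (elim exE conjE)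
  let ?a = "total_x u" and ?b = "total_y u"
  have w': "word_from (allowed 0 0) 0 (u @ s # v)" using w usv by (simp add: origin_tangency)
  note pos = word_from_append[OF origin_tangency(1) w', unfolded add_0, folded origin_lattice]
  have s: "s \<in> allowed ?a ?b" using pos(2) by simp
  note next_pos = tangency_step[OF pos(1) s]
  have wf: "word_from {Up, DownBar} 0 (u @ s # v)" using w usv by simp
  have sub: "path_points (lattice_point ?a ?b) (s # v) \<subseteq> path_points 0 w"
    unfolding usv path_points_append pos(3) by blast
  have "\<exists>e \<beta>. c = lattice_point e \<beta> \<and> c \<in> centers \<and> 0 \<le> \<beta> \<and>
      (e = ?a \<and> \<beta> + 2 \<le> ?b \<or> s = Flat \<and> e = ?a + 1 \<and> \<beta> + 1 \<le> ?b \<or>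
       s = FlatBar \<and> e = ?a + 1 \<and> \<beta> + 3 \<le> ?b)"
    using c by (cases s) (auto simp: circles_below_def)
  then obtain e \<beta> where e: "c = lattice_point e \<beta>" "lattice_point e \<beta> \<in> centers" "0 \<le> \<beta>"
    and cases: "e = ?a \<and> \<beta> + 2 \<le> ?b \<or> s = Flat \<and> e = ?a + 1 \<and> \<beta> + 1 \<le> ?b \<or>
       s = FlatBar \<and> e = ?a + 1 \<and> \<beta> + 3 \<le> ?b"
    by auto
  have "covered c (path_points 0 w) x" if x: "of_int (e - 2) \<le> x" "x \<le> of_int (e + 2)" for x
  proof (cases "e = ?a \<and> \<beta> + 2 \<le> ?b")
    case True
    show ?thesis
    proof (cases "x \<le> of_int e")
      case le: True
      show ?thesis unfolding usv e(1) by (rule covers_left_0[OF wf]) (use e True le x in auto)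
    next
      case False
      have "covered c (path_points (lattice_point ?a ?b) (s # v)) x"
        unfolding e(1) conjunct1[OF True]
        by (rule covers_right_0[OF pos(1,2)]) (use e True False x in auto)
      then show ?thesis using sub by (rule covered_mono)
    qed
  next
    case False
    then have F: "s = Flat \<and> e = ?a + 1 \<and> \<beta> + 1 \<le> ?b \<or> s = FlatBar \<and> e = ?a + 1 \<and> \<beta> + 3 \<le> ?b"
      using cases by blast
    consider "x \<le> of_int (e - 1)" | "of_int (e - 1) \<le> x" "x \<le> of_int (e + 1)" | "of_int (e + 1) \<le> x"
      by linarith
    then show ?thesis
    proof cases
      case 1
      show ?thesis unfolding usv e(1) by (rule covers_left_1[OF wf]) (use e F 1 x in auto)
    next
      case 2
      have "covered c (arc_points (lattice_point ?a ?b) s) x"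
        unfolding e(1) by (rule arc_covers[OF pos(1) s]) (use e F 2 in \<open>auto simp: upper_steps_def\<close>)
      then show ?thesis by (rule covered_mono) (use sub in auto)
    next
      case 3
      have "covered c (path_points (lattice_point (?a + disp_x s) (?b + disp_y s)) v) x"
        unfolding e(1)
      proof (rule covers_right_1[OF next_pos(1)])
        show "word_from (allowed (?a + disp_x s) (?b + disp_y s)) (?b + disp_y s) v"
          using pos(2) next_pos(2) by simp
      qed (use e F 3 x in auto)
      then show ?thesis by (rule covered_mono) (use sub in \<open>simp add: arc_end_lattice\<close>)
    qed
  qed
  then have "circle_under c w" unfolding circle_under_iff_covered by (simp add: e(1))
  then show ?thesis using e by simp
qed

text \<open>Turns vertical gaps into lattice gaps: 2 is the radius, from a centre to the top of its
  circle, and 4 adds the radius of the circle that carries a \<open>FlatBar\<close> arc.\<close>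

lemma sqrt3_mult_ge:
  "2 \<le> sqrt 3 * of_int k \<Longrightarrow> 2 \<le> k" "4 \<le> sqrt 3 * of_int k \<Longrightarrow> 3 \<le> k"
proof -
  have s: "sqrt 3 < 2" by (rule real_less_lsqrt) auto
  have le: "sqrt 3 * of_int k \<le> sqrt 3 * of_int m" if "k \<le> m" for m
    using that by simp
  show "2 \<le> k" if "2 \<le> sqrt 3 * of_int k"
  proof (rule ccontr)
    assume "\<not> 2 \<le> k"
    then have "k \<le> 1" by simp
    then have "sqrt 3 * of_int k \<le> sqrt 3" using le[of 1] by (simp only: of_int_1 mult_1_right)
    with that s show False by linarith
  qed
  show "3 \<le> k" if "4 \<le> sqrt 3 * of_int k"
  proof (rule ccontr)
    assume "\<not> 3 \<le> k"
    then have "k \<le> 2" by simp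
    then have "sqrt 3 * of_int k \<le> sqrt 3 * 2" using le[of 2] by (simp only: of_int_numeral)
    with that s show False by linarith
  qed
qed

text \<open>One point of the path over the top of the circle identifies the charged step. Centres
  have even abscissas, so the vertical line through the centre meets an arc at its even end, or in
  the middle if the arc is flat; the height there is known.\<close>

lemma word_circles_complete:
  assumes "tangency a b" "word_from (allowed a b) b w"
    and "lattice_point e \<beta> \<in> centers" "0 \<le> \<beta>"
    and "v \<in> path_points (lattice_point a b) w" "Re v = of_int e" "sqrt 3 * of_int \<beta> + 2 \<le> Im v"
  shows "lattice_point e \<beta> \<in> word_circles a b w"
  using assms
proof (induction w arbitrary: a b)
  case Nil
  then have "b = 0" by simp
  then have "Im v = 0" using Nil.prems(5) by simp
  moreover have "0 \<le> sqrt 3 * real_of_int \<beta>" using Nil.prems(4) by simp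
  ultimately show ?case using Nil.prems(7) by linarith
next
  case (Cons s w)
  let ?p = "lattice_point a b"
  have s: "s \<in> allowed a b" using Cons.prems by simp
  note step = tangency_step[OF Cons.prems(1) s]
  have rest: ?case if "v \<in> path_points (lattice_point (a + disp_x s) (b + disp_y s)) w"
    using Cons.IH[OF step(1) _ Cons.prems(3,4) that Cons.prems(6,7)] Cons.prems(2) step(2) by simp
  have center: "even \<beta>" "(e - \<beta>) mod 4 = 2" "even e"
    using Cons.prems(3) unfolding lattice_point_in_centers by (auto, presburger)
  show ?case
  proof (cases "v \<in> arc_points ?p s")
    case False
    then show ?thesis using Cons.prems(5) rest by (simp add: arc_end_lattice)
  next
    case True
    note bounds = arc_points_bounds[OF True, unfolded arc_end_lattice arc_center_lattice]
    have "(cmod (v - lattice_point (a + center_x s) (b + center_y s)))\<^sup>2 = 2\<^sup>2"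
      using bounds(1) by (simp add: dist_norm norm_minus_commute)
    then have sq: "(of_int (e - (a + center_x s)))\<^sup>2 + (Im v - sqrt 3 * of_int (b + center_y s))\<^sup>2 = (2::real)\<^sup>2"
      unfolding cmod_power2 using Cons.prems(6) by simp
    have ea: "a \<le> e" "e \<le> a + disp_x s"
      using bounds(2,3) Cons.prems(6) by simp_all
    have start: "lattice_point a' b' \<in> path_points (lattice_point a' b') w" for a' b'
      using endpoint_in_path_points[of _ 0] by simp
    show ?thesis
    proof (cases s)
      case Up
      then have "(a - b) mod 4 = 0 \<and> even b" using s by (simp add: allowed_iff)
      then have "e = a" using ea[unfolded Up disp_x.simps] center(3) by presburger
      then have "Im v = sqrt 3 * of_int b" using sq Up by simp
      then have "2 \<le> sqrt 3 * of_int (b - \<beta>)" using Cons.prems(7) by (simp add: algebra_simps)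
      then have "\<beta> \<le> b - 2" using sqrt3_mult_ge(1) by fastforce
      then show ?thesis using Up \<open>e = a\<close> Cons.prems(3,4) by (auto simp: circles_below_def)
    next
      case DownBar
      then have "(a - b) mod 4 = 0 \<and> even b" using s by (simp add: allowed_iff)
      then have "e = a" using ea[unfolded DownBar disp_x.simps] center(3) by presburger
      then have "Im v = sqrt 3 * of_int b" using sq DownBar by simp
      then have "2 \<le> sqrt 3 * of_int (b - \<beta>)" using Cons.prems(7) by (simp add: algebra_simps)
      then have "\<beta> \<le> b - 2" using sqrt3_mult_ge(1) by fastforce
      then show ?thesis using DownBar \<open>e = a\<close> Cons.prems(3,4) by (auto simp: circles_below_def)
    next
      case Flat
      then have "(a - b) mod 4 = 0 \<and> odd b" using s by (simp add: allowed_iff)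
      then have e: "e = a + 1" using ea[unfolded Flat disp_x.simps] center(3) by presburger
      then have "(Im v - sqrt 3 * of_int (b - 1))\<^sup>2 = 2\<^sup>2" using sq Flat by simp
      then have "Im v - sqrt 3 * of_int (b - 1) \<le> 2" by (auto intro: power2_le_imp_le[of _ 2])
      then have "0 \<le> sqrt 3 * of_int (b - 1 - \<beta>)" using Cons.prems(7) by (simp add: algebra_simps)
      then have "\<beta> \<le> b - 1" by (simp add: zero_le_mult_iff)
      then show ?thesis using Flat e Cons.prems(3,4) by (auto simp: circles_below_def)
    next
      case FlatBar
      then have b: "(a - b) mod 4 = 2 \<and> odd b" using s Cons.prems(1) by (simp add: allowed_iff)
      then have e: "e = a + 1" using ea[unfolded FlatBar disp_x.simps] center(3) by presburger
      then have "(Im v - sqrt 3 * of_int (b + 1))\<^sup>2 = 2\<^sup>2" using sq FlatBar by simp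
      \<comment> \<open>The arc is on the lower half of its circle, which selects the root
        -2.\<close>
      moreover have "Im v - sqrt 3 * of_int (b + 1) \<le> 0"
        using bounds(5) FlatBar by (simp add: upper_steps_def)
      ultimately have "Im v - sqrt 3 * of_int (b + 1) = - 2" unfolding power2_eq_iff by auto
      then have "4 \<le> sqrt 3 * of_int (b + 1 - \<beta>)" using Cons.prems(7) by (simp add: algebra_simps)
      then have "3 \<le> b + 1 - \<beta>" by (rule sqrt3_mult_ge(2))
      \<comment> \<open>The gap alone gives \<open>b - 2\<close>; \<open>b\<close> is odd and
        \<open>\<beta>\<close> even, which gains one more.\<close>
      then have "\<beta> \<le> b - 3" using b center(1) by presburger
      then show ?thesis using FlatBar e Cons.prems(3,4) by (auto simp: circles_below_def)
    next
      case UpBar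
      then have "(a - b) mod 4 = 0 \<and> odd b" using s by (simp add: allowed_iff)
      then have e: "e = a + 1" using ea[unfolded UpBar disp_x.simps] center(3) by presburger
      \<comment> \<open>The line meets the arc at its right end, which is the start of the remaining
        word; the induction hypothesis takes over.\<close>
      then have "v = lattice_point (a + 1) (b + 1)" using sq UpBar Cons.prems(6) by (simp add: complex_eq_iff)
      then show ?thesis using start UpBar by (intro rest) simp
    next
      case Down
      then have "(a - b) mod 4 = 2 \<and> odd b" using s Cons.prems(1) by (simp add: allowed_iff)
      then have e: "e = a + 1" using ea[unfolded Down disp_x.simps] center(3) by presburger
      then have "v = lattice_point (a + 1) (b - 1)" using sq Down Cons.prems(6) by (simp add: complex_eq_iff)
      then show ?thesis using start Down by (intro rest) simp
    qed
  qed
qed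

lemma centers_lattice_point:
  assumes "c \<in> centers"
  obtains e \<beta> where "c = lattice_point e \<beta>"
proof -
  obtain i j :: int where "c = Complex (2 + 4 * of_int i + 2 * of_int j) (2 * sqrt 3 * of_int j)"
    using assms by (auto simp: centers_def)
  then have "c = lattice_point (2 + 4 * i + 2 * j) (2 * j)" by (simp add: complex_eq_iff)
  then show ?thesis by (rule that)
qed

lemma area_eq:
  assumes w: "word_from {Up, DownBar} 0 w"
  shows "area w = word_wt 0 w"
proof -
  have "{c \<in> centers. 0 \<le> Im c \<and> circle_under c w} = word_circles 0 0 w"
  proof (intro equalityI subsetI)
    fix c assume c: "c \<in> {c \<in> centers. 0 \<le> Im c \<and> circle_under c w}"
    then obtain e \<beta> where e: "c = lattice_point e \<beta>" using centers_lattice_point by blast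
    \<comment> \<open>The topmost point of the circle: the path point above it is the input of
      \<open>word_circles_complete\<close>.\<close>
    have "c + Complex 0 2 \<in> sphere c 2" by (simp add: dist_norm cmod_def)
    with c obtain v where "v \<in> path_points 0 w" "Re v = Re (c + Complex 0 2)" "Im (c + Complex 0 2) \<le> Im v"
      unfolding circle_under_def by blast
    then have "v \<in> path_points 0 w" "Re v = Re c" "Im c + 2 \<le> Im v" by simp_all
    then show "c \<in> word_circles 0 0 w"
      using word_circles_complete[OF origin_tangency(1), of w e \<beta> v] w c e
      by (simp add: origin_tangency zero_le_mult_iff flip: origin_lattice)
  qed (use word_circles_under[OF w] in simp)
  then show ?thesis
    unfolding area_def using card_word_circles[OF origin_tangency(1), of w] w
    by (simp add: origin_tangency)
qed

theorem theorem7: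
  shows "\<exists>K :: nat \<Rightarrow> rat fps fps.
    (\<forall>j\<ge>2. (\<lambda>n. cf_tail n j) \<longlonglongrightarrow> K j) \<and>
    (\<forall>j\<ge>2. K j = X ^ 4 * Y ^ j / (1 - 3 * X ^ 4 * Y ^ j - K (Suc j))) \<and>
    packing_gf = 1 / (1 - 2 * X ^ 4 * Y / (1 - 2 * X ^ 4 * Y - K 2)) \<and>
    (\<lambda>n. 1 / (1 - 2 * X ^ 4 * Y / (1 - 2 * X ^ 4 * Y - cf_tail n 2))) \<longlonglongrightarrow> packing_gf"
proof -
  have q: "2 * X ^ 4 * Y = 2 * circle_wt 1" "\<And>j. X ^ 4 * Y ^ j = circle_wt j"
    "\<And>j. 3 * X ^ 4 * Y ^ j = 3 * circle_wt j"
    by (simp_all add: circle_wt_def mult.assoc)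
  have gf: "packing_gf = 1 / (1 - 2 * circle_wt 1 / (1 - 2 * circle_wt 1 - cf_lim 2))"
    using packing_gf_eq[OF area_eq] word_gf_cf by (rule trans)
  show ?thesis unfolding q
  proof (intro exI[of _ cf_lim] conjI allI impI)
    show "(\<lambda>n. cf_tail n j) \<longlonglongrightarrow> cf_lim j" for j by (rule cf_tail_tendsto)
    show "cf_lim j = circle_wt j / (1 - 3 * circle_wt j - cf_lim (Suc j))" for j by (rule cf_lim_rec)
    show "packing_gf = 1 / (1 - 2 * circle_wt 1 / (1 - 2 * circle_wt 1 - cf_lim 2))" by (rule gf)
    show "(\<lambda>n. 1 / (1 - 2 * circle_wt 1 / (1 - 2 * circle_wt 1 - cf_tail n 2))) \<longlonglongrightarrow> packing_gf"
      unfolding gf by (rule cf_top_tendsto)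
  qed
qed

end
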